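(* Let $X=(\mathcal{S}^0,J)$ be an Inoue surface of type $\mathcal{S}^0$, i.e. $\mathcal{S}^0=(\mathbb{C}\times\mathbb{H})/G_A$ with the complex structure $J$ inherited from $\mathbb{C}\times\mathbb{H}$, and let $\theta$ be the one-form on $\mathcal{S}^0$ induced by $\frac{dw_2}{w_2}$, $w_2=\operatorname{Im}w$. Then $$\mathcal{T}(X)=\{[\theta]\}\subset H^1_{dR}(\mathcal{S}^0).$$
   Context: For a closed one-form $\eta$, $d_\eta=d-\eta\wedge\cdot$. For a compact complex surface $X=(M,J)$, $$\mathcal{T}(X)=\{[\eta]\in H^1_{dR}(M)\mid \text{there exists a real } \omega\in\Omega^2(X) \text{ with } \omega^{1,1}>0 \text{ and } d_\eta\omega=0\},$$ where $\omega^{1,1}$ is the $(1,1)$-part of $\omega$, and $\omega^{1,1}>0$ means that $\omega$ tames $J$, i.e. $\omega(Y,JY)>0$ for every nonzero tangent vector $Y$. So $\mathcal{T}(X)$ is the set of Lee classes of locally conformally symplectic forms taming $J$. Inoue surface $\mathcal{S}^0$: let $A\in \mathrm{SL}_3(\mathbb{Z})$ have one real eigenvalue $\alpha>1$ and two complex (non-real) eigenvalues $\beta,\bar\beta$. Let $(a_1,a_2,a_3)^t$ be a real eigenvector for $\alpha$ and $(b_1,b_2,b_3)^t$ a complex eigenvector for $\beta$. Let $\mathbb{H}$ be the upper half-plane and $G_A$ the group of transformations of $\mathbb{C}\times\mathbb{H}$ (coordinates $(z,w)$) generated by $(z,w)\mapsto(\beta z,\alpha w)$ and $(z,w)\mapsto(z+b_i,w+a_i)$,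 $i=1,2,3$. Then $\mathcal{S}^0=(\mathbb{C}\times\mathbb{H})/G_A$, a compact complex surface. The form $\frac{dw_2}{w_2}$ is $G_A$-invariant and descends to $\mathcal{S}^0$; it is the Lee form of Tricerri's LCK metric. *)

theory Defs
  imports "HOL-Analysis.Analysis" "HOL-Algebra.Bij" "HOL-Algebra.Generated_Groups"
begin

section \<open>Smooth functions and exterior calculus on open subsets of $\mathbb{C}^2$\<close>

type_synonym C2 = "complex \<times> complex"

primrec Ck_on :: "nat \<Rightarrow> C2 set \<Rightarrow> (C2 \<Rightarrow> real) \<Rightarrow> bool" where
  "Ck_on 0 U f \<longleftrightarrow> continuous_on U f"
| "Ck_on (Suc k) U f \<longleftrightarrow>
     (\<forall>p\<in>U. f differentiable (at p)) \<and> (\<forall>v. Ck_on k U (\<lambda>p. frechet_derivative f (at p) v))"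

definition smooth_on :: "C2 set \<Rightarrow> (C2 \<Rightarrow> real) \<Rightarrow> bool" where
  "smooth_on U f \<longleftrightarrow> (\<forall>k. Ck_on k U f)"

text \<open>The tangent space at every point is \<open>C2\<close> as a real vector space of dimension 4. Thus
  a real 1-form is a function of a point and one tangent vector, a real 2-form a function of a
  point and two tangent vectors. No factorials occur in the conventions for \<open>d\<close> and the wedge
  product: $(\alpha \wedge \beta)(u,v) = \alpha(u)\beta(v) - \alpha(v)\beta(u)$.\<close>

type_synonym form1 = "C2 \<Rightarrow> C2 \<Rightarrow> real"
type_synonym form2 = "C2 \<Rightarrow> C2 \<Rightarrow> C2 \<Rightarrow> real"
type_synonym form3 = "C2 \<Rightarrow> C2 \<Rightarrow> C2 \<Rightarrow> C2 \<Rightarrow> real"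

definition ext_d0 :: "(C2 \<Rightarrow> real) \<Rightarrow> form1" where
  "ext_d0 f p v = frechet_derivative f (at p) v"

definition ext_d1 :: "form1 \<Rightarrow> form2" where
  "ext_d1 \<eta> p u v = ext_d0 (\<lambda>x. \<eta> x v) p u - ext_d0 (\<lambda>x. \<eta> x u) p v"

definition ext_d2 :: "form2 \<Rightarrow> form3" where
  "ext_d2 \<omega> p u v w =
     ext_d0 (\<lambda>x. \<omega> x v w) p u - ext_d0 (\<lambda>x. \<omega> x u w) p v + ext_d0 (\<lambda>x. \<omega> x u v) p w"

definition wedge12 :: "form1 \<Rightarrow> form2 \<Rightarrow> form3" where
  "wedge12 \<eta> \<omega> p u v w = \<eta> p u * \<omega> p v w - \<eta> p v * \<omega> p u w + \<eta> p w * \<omega> p u v"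

definition twisted_d2 :: "form1 \<Rightarrow> form2 \<Rightarrow> form3" where
  "twisted_d2 \<eta> \<omega> p u v w = ext_d2 \<omega> p u v w - wedge12 \<eta> \<omega> p u v w"

text \<open>The standard complex structure on the tangent spaces.\<close>

definition J_std :: "C2 \<Rightarrow> C2" where
  "J_std v = (\<i> * fst v, \<i> * snd v)"

section \<open>Forms on a complex surface given by an atlas\<close>

text \<open>A chart consists of its domain and its coordinate map; the latter is only relevant on the
  domain.\<close>

type_synonym 'a chart = "'a set \<times> ('a \<Rightarrow> C2)"

definition chart_target :: "'a chart \<Rightarrow> C2 set" where
  "chart_target c = snd c ` fst c"

definition chart_inv :: "'a chart \<Rightarrow> C2 \<Rightarrow> 'a" where
  "chart_inv c = inv_into (fst c) (snd c)"

definition chart_overlap :: "'a chart \<Rightarrow> 'a chart \<Rightarrow> C2 set" where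
  "chart_overlap c c' = snd c ` (fst c \<inter> fst c')"

definition transition :: "'a chart \<Rightarrow> 'a chart \<Rightarrow> C2 \<Rightarrow> C2" where
  "transition c c' = snd c' \<circ> chart_inv c"

text \<open>A differential form on the surface is the family of its coordinate expressions, one on each
  chart target, which are matched by pullback along the transition maps.\<close>

definition smooth_fun :: "'a chart set \<Rightarrow> ('a \<Rightarrow> real) \<Rightarrow> bool" where
  "smooth_fun \<A> f \<longleftrightarrow> (\<forall>c\<in>\<A>. smooth_on (chart_target c) (f \<circ> chart_inv c))"

definition one_form :: "'a chart set \<Rightarrow> ('a chart \<Rightarrow> form1) \<Rightarrow> bool" where
  "one_form \<A> \<eta> \<longleftrightarrow>
     (\<forall>c\<in>\<A>. (\<forall>p\<in>chart_target c. linear (\<eta> c p)) \<and>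
            (\<forall>v. smooth_on (chart_target c) (\<lambda>p. \<eta> c p v))) \<and>
     (\<forall>c\<in>\<A>. \<forall>c'\<in>\<A>. \<forall>p\<in>chart_overlap c c'. \<forall>v.
        \<eta> c p v = \<eta> c' (transition c c' p) (frechet_derivative (transition c c') (at p) v))"

definition two_form :: "'a chart set \<Rightarrow> ('a chart \<Rightarrow> form2) \<Rightarrow> bool" where
  "two_form \<A> \<omega> \<longleftrightarrow>
     (\<forall>c\<in>\<A>. (\<forall>p\<in>chart_target c. bilinear (\<omega> c p) \<and> (\<forall>u. \<omega> c p u u = 0)) \<and>
            (\<forall>u v. smooth_on (chart_target c) (\<lambda>p. \<omega> c p u v))) \<and>
     (\<forall>c\<in>\<A>. \<forall>c'\<in>\<A>. \<forall>p\<in>chart_overlap c c'. \<forall>u v.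
        \<omega> c p u v = \<omega> c' (transition c c' p)
          (frechet_derivative (transition c c') (at p) u)
          (frechet_derivative (transition c c') (at p) v))"

definition closed_one_forms :: "'a chart set \<Rightarrow> ('a chart \<Rightarrow> form1) set" where
  "closed_one_forms \<A> =
     {\<eta>. one_form \<A> \<eta> \<and> (\<forall>c\<in>\<A>. \<forall>p\<in>chart_target c. \<forall>u v. ext_d1 (\<eta> c) p u v = 0)}"

text \<open>The values of a family outside the chart targets carry no information; families that agree on
  the targets are identified by the relation below (take \<open>f = 0\<close>).\<close>

definition cohomologous :: "'a chart set \<Rightarrow> (('a chart \<Rightarrow> form1) \<times> ('a chart \<Rightarrow> form1)) set" where
  "cohomologous \<A> =
     {(\<eta>, \<eta>'). \<eta> \<in> closed_one_forms \<A> \<and> \<eta>' \<in> closed_one_forms \<A> \<and>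
        (\<exists>f. smooth_fun \<A> f \<and>
          (\<forall>c\<in>\<A>. \<forall>p\<in>chart_target c. \<forall>v. \<eta>' c p v - \<eta> c p v = ext_d0 (f \<circ> chart_inv c) p v))}"

definition deRham_H1 :: "'a chart set \<Rightarrow> ('a chart \<Rightarrow> form1) set set" where
  "deRham_H1 \<A> = closed_one_forms \<A> // cohomologous \<A>"

definition deRham_class :: "'a chart set \<Rightarrow> ('a chart \<Rightarrow> form1) \<Rightarrow> ('a chart \<Rightarrow> form1) set" where
  "deRham_class \<A> \<eta> = cohomologous \<A> `` {\<eta>}"

text \<open>Since $\omega^{1,1}(Y,Z) = \frac12(\omega(Y,Z) + \omega(JY,JZ))$ satisfies
  $\omega^{1,1}(Y,JY) = \omega(Y,JY)$, the following is $\omega^{1,1} > 0$.\<close>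

definition tames_J :: "'a chart set \<Rightarrow> ('a chart \<Rightarrow> form2) \<Rightarrow> bool" where
  "tames_J \<A> \<omega> \<longleftrightarrow>
     (\<forall>c\<in>\<A>. \<forall>p\<in>chart_target c. \<forall>v. v \<noteq> 0 \<longrightarrow> \<omega> c p v (J_std v) > 0)"

text \<open>The set $\mathcal{T}(X)$ of Lee classes of locally conformally symplectic forms taming \<open>J\<close>.\<close>

definition taming_Lee_classes :: "'a chart set \<Rightarrow> ('a chart \<Rightarrow> form1) set set" where
  "taming_Lee_classes \<A> =
     {h \<in> deRham_H1 \<A>. \<exists>\<eta>. \<eta> \<in> closed_one_forms \<A> \<and> h = deRham_class \<A> \<eta> \<and>
        (\<exists>\<omega>. two_form \<A> \<omega> \<and> tames_J \<A> \<omega> \<and>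
          (\<forall>c\<in>\<A>. \<forall>p\<in>chart_target c. \<forall>u v w. twisted_d2 (\<eta> c) (\<omega> c) p u v w = 0))}"

section \<open>Inoue surfaces of type $\mathcal{S}^0$\<close>

text \<open>Since \<open>A\<close> is real and \<open>\<beta>\<close> is not, \<open>cnj \<beta>\<close> is an eigenvalue of \<open>A\<close> as well, so that
  \<open>\<alpha>\<close>, \<open>\<beta>\<close> and \<open>cnj \<beta>\<close> are all the eigenvalues of \<open>A\<close>.\<close>

definition inoue_S0_data ::
  "int^3^3 \<Rightarrow> real \<Rightarrow> complex \<Rightarrow> real^3 \<Rightarrow> complex^3 \<Rightarrow> bool" where
  "inoue_S0_data A \<alpha> \<beta> a b \<longleftrightarrow>
     det A = 1 \<and> \<alpha> > 1 \<and> \<beta> \<notin> \<real> \<and>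
     a \<noteq> 0 \<and> map_matrix of_int A *v a = \<alpha> *s a \<and>
     b \<noteq> 0 \<and> map_matrix of_int A *v b = \<beta> *s b"

definition CxH :: "C2 set" where
  "CxH = {(z, w). Im w > 0}"

definition inoue_group :: "real \<Rightarrow> complex \<Rightarrow> real^3 \<Rightarrow> complex^3 \<Rightarrow> (C2 \<Rightarrow> C2) set" where
  "inoue_group \<alpha> \<beta> a b =
     generate (BijGroup CxH)
       ({\<lambda>(z, w)\<in>CxH. (\<beta> * z, of_real \<alpha> * w)} \<union>
        {\<lambda>(z, w)\<in>CxH. (z + b $ i, w + of_real (a $ i)) | i. True})"

definition inoue_proj :: "real \<Rightarrow> complex \<Rightarrow> real^3 \<Rightarrow> complex^3 \<Rightarrow> C2 \<Rightarrow> C2 set" where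
  "inoue_proj \<alpha> \<beta> a b p = (\<lambda>g. g p) ` inoue_group \<alpha> \<beta> a b"

text \<open>The points of the quotient are the orbits, and its charts are the inverses of the restrictions
  of the projection to open sets on which it is injective. This is the complex structure
  inherited from the covering.\<close>

definition inoue_S0 :: "real \<Rightarrow> complex \<Rightarrow> real^3 \<Rightarrow> complex^3 \<Rightarrow> C2 set chart set" where
  "inoue_S0 \<alpha> \<beta> a b =
     {(inoue_proj \<alpha> \<beta> a b ` U, inv_into U (inoue_proj \<alpha> \<beta> a b)) | U.
        open U \<and> U \<subseteq> CxH \<and> inj_on (inoue_proj \<alpha> \<beta> a b) U}"

text \<open>The coordinate expression of a form in one of these charts is its pullback under the
  projection, restricted to the chart target. So the form induced by the invariant form
  $dw_2 / w_2$, where $w_2 = \mathrm{Im}\, w$, has the same expression in every chart.\<close>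

definition inoue_theta :: "C2 set chart \<Rightarrow> form1" where
  "inoue_theta c p v = Im (snd v) / Im (snd p)"

end

theory Submission
  imports Defs
begin

text \<open>
  Pull everything back to the covering \<open>\<complex> \<times> \<H>\<close>. Its deck group is generated by a lattice of translations
  of \<open>\<complex> \<times> \<real>\<close>, spanned by \<open>e i = (b i, a i)\<close>, and by the dilation \<open>D (z, w) = (\<beta> z, \<alpha> w)\<close>, which
  acts on the lattice as the matrix \<open>A\<close>. Hence the surface fibres over a circle with coordinate
  \<open>ln (Im w)\<close> modulo \<open>ln \<alpha>\<close>, with 3-tori as fibres and monodromy \<open>A\<close>. The determinant of \<open>A\<close> gives
  \<open>\<alpha> |\<beta>|^2 = 1\<close>.

  A closed one-form \<open>\<eta>\<close> becomes \<open>dF\<close> on the covering. The periods of \<open>F\<close> over the lattice are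
  fixed by \<open>A\<close>, which does not have the eigenvalue 1, so they vanish
  (\<open>potential_periods\<close>). Only the number \<open>c\<close> in \<open>F \<circ> D = F + c\<close> remains, and \<open>\<eta>\<close> is cohomologous to
  \<open>(c / ln \<alpha>) \<theta>\<close>. The claim is therefore \<open>exp c = \<alpha>\<close> for every Lee form of a taming form \<open>\<omega>\<close>.

  The form \<open>\<Omega> = exp (- F) \<omega>\<close> is closed and invariant under the lattice, and \<open>D\<close> pulls it back to
  \<open>exp (- c) \<Omega>\<close>. Write \<open>z = x + i y\<close> and let \<open>f s\<close> be the average of \<open>\<Omega>(\<partial>_x, \<partial>_y)\<close> over the torus
  \<open>Im w = s\<close>. It is positive because \<open>\<omega>\<close> tames \<open>J\<close>. It is constant because \<open>d\<Omega> = 0\<close> expresses its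
  \<open>s\<close>-derivative by averages of derivatives of periodic functions along the torus. Finally
  \<open>f (\<alpha> s) = exp (- c) |\<beta>|^(- 2) f s = exp (- c) \<alpha> f s\<close>, whence \<open>exp c = \<alpha>\<close> (\<open>closed_form_multiplier\<close>,
  \<open>dilation_period\<close>). The averages are taken over the finite grids \<open>(1/N) \<int>^3\<close> modulo \<open>\<int>^3\<close>: \<open>A\<close> permutes
  each of them, so invariance under the monodromy is exact, and the statements on derivatives hold
  in the limit \<open>N \<longrightarrow> \<infinity>\<close>.

  Conversely, the fundamental form of the metric of Tricerri tames \<open>J\<close> and has Lee form \<open>\<theta>\<close>.
\<close>

section \<open>Smooth functions\<close>

lemma Ck_on_imp_continuous_on:
  assumes "Ck_on k U f"
  shows "continuous_on U f"
proof (cases k)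
  case (Suc m)
  then show ?thesis
    using assms by (auto intro!: continuous_at_imp_continuous_on differentiable_imp_continuous_within)
qed (use assms in auto)

lemma Ck_on_local:
  assumes "\<And>p. p \<in> W \<Longrightarrow> \<exists>U g. open U \<and> p \<in> U \<and> Ck_on k U g \<and> (\<forall>x\<in>U. f x = g x)"
  shows "Ck_on k W f"
  using assms
proof (induction k arbitrary: f)
  case 0
  have "isCont f p" if "p \<in> W" for p
  proof -
    obtain U g where U: "open U" "p \<in> U" "continuous_on U g" "\<forall>x\<in>U. f x = g x"
      using 0[OF \<open>p \<in> W\<close>] by auto
    have "continuous_on U f"
      using U(3,4) continuous_on_cong[of U U f g] by blast
    then show ?thesis
      using U(1,2) continuous_on_eq_continuous_at by blast
  qed
  then show ?case
    by (simp add: continuous_at_imp_continuous_on)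
next
  case (Suc k)
  have loc: "\<exists>U g. open U \<and> p \<in> U \<and> Ck_on (Suc k) U g \<and>
      (\<forall>x\<in>U. f differentiable (at x) \<and> frechet_derivative f (at x) = frechet_derivative g (at x))"
    if "p \<in> W" for p
  proof -
    obtain U g where U: "open U" "p \<in> U" "Ck_on (Suc k) U g" "\<forall>x\<in>U. f x = g x"
      using Suc.prems[OF \<open>p \<in> W\<close>] by auto
    have "f differentiable (at x) \<and> frechet_derivative f (at x) = frechet_derivative g (at x)"
      if "x \<in> U" for x
    proof -
      have "(g has_derivative frechet_derivative g (at x)) (at x)"
        using U(3) that by (simp add: frechet_derivative_works)
      then have "(f has_derivative frechet_derivative g (at x)) (at x)"
        using has_derivative_transform_within_open[OF _ U(1) that] U(4) by fastforce
      then show ?thesis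
        by (metis differentiable_def frechet_derivative_at)
    qed
    then show ?thesis
      using U by blast
  qed
  have "Ck_on k W (\<lambda>p. frechet_derivative f (at p) v)" for v
  proof (rule Suc.IH)
    fix p assume "p \<in> W"
    from loc[OF this] obtain U g where
      "open U" "p \<in> U" "Ck_on (Suc k) U g"
      "\<forall>x\<in>U. frechet_derivative f (at x) = frechet_derivative g (at x)"
      by blast
    then show "\<exists>U g. open U \<and> p \<in> U \<and> Ck_on k U g \<and> (\<forall>x\<in>U. frechet_derivative f (at x) v = g x)"
      by (metis Ck_on.simps(2))
  qed
  moreover have "f differentiable (at p)" if "p \<in> W" for p
    using loc[OF that] by blast
  ultimately show ?case
    by simp
qed

lemma Ck_on_subset: "Ck_on k U f \<Longrightarrow> V \<subseteq> U \<Longrightarrow> Ck_on k V f"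
  by (induction k arbitrary: f) (auto intro: continuous_on_subset)

lemma Ck_on_cong: "open U \<Longrightarrow> Ck_on k U g \<Longrightarrow> (\<And>x. x \<in> U \<Longrightarrow> f x = g x) \<Longrightarrow> Ck_on k U f"
  by (rule Ck_on_local) blast

lemma smooth_on_local:
  assumes "\<And>p. p \<in> W \<Longrightarrow> \<exists>U g. open U \<and> p \<in> U \<and> smooth_on U g \<and> (\<forall>x\<in>U. f x = g x)"
  shows "smooth_on W f"
  unfolding smooth_on_def
proof
  fix k
  show "Ck_on k W f"
  proof (rule Ck_on_local)
    fix p assume "p \<in> W"
    from assms[OF this] obtain U g where
      "open U" "p \<in> U" "smooth_on U g" "\<forall>x\<in>U. f x = g x"
      by (elim exE conjE)
    then show "\<exists>U g. open U \<and> p \<in> U \<and> Ck_on k U g \<and> (\<forall>x\<in>U. f x = g x)"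
      by (intro exI[of _ U] exI[of _ g]) (simp add: smooth_on_def)
  qed
qed

lemma smooth_on_cong: "open U \<Longrightarrow> smooth_on U g \<Longrightarrow> (\<And>x. x \<in> U \<Longrightarrow> f x = g x) \<Longrightarrow> smooth_on U f"
  by (rule smooth_on_local) blast

lemma smooth_on_subset: "smooth_on U f \<Longrightarrow> V \<subseteq> U \<Longrightarrow> smooth_on V f"
  unfolding smooth_on_def using Ck_on_subset by blast

lemma smooth_on_has_derivative:
  "smooth_on U f \<Longrightarrow> p \<in> U \<Longrightarrow> (f has_derivative ext_d0 f p) (at p)"
  unfolding smooth_on_def ext_d0_def by (metis Ck_on.simps(2) frechet_derivative_works)

lemma smooth_on_ext_d0: "smooth_on U f \<Longrightarrow> smooth_on U (\<lambda>p. ext_d0 f p v)"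
  unfolding smooth_on_def ext_d0_def by (metis Ck_on.simps(2))

lemma smooth_on_imp_continuous_on: "smooth_on U f \<Longrightarrow> continuous_on U f"
  unfolding smooth_on_def using Ck_on_imp_continuous_on by blast

lemma ext_d0_eqI: "(f has_derivative f') (at p) \<Longrightarrow> ext_d0 f p v = f' v"
  unfolding ext_d0_def by (metis frechet_derivative_at)

lemma ext_d0_cong:
  assumes "open U" "p \<in> U" "\<And>x. x \<in> U \<Longrightarrow> f x = g x"
  shows "ext_d0 f p v = ext_d0 g p v"
proof -
  have "(f has_derivative D) (at p) \<longleftrightarrow> (g has_derivative D) (at p)" for D
    using has_derivative_transform_within_open[of f D p UNIV U g]
      has_derivative_transform_within_open[of g D p UNIV U f] assms by metis
  then show ?thesis
    by (simp add: ext_d0_def frechet_derivative_def)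
qed

text \<open>This yields smoothness of the potential of a smooth one-form without any further differentiation
  under the integral sign.\<close>

lemma smooth_on_if_derivative:
  assumes "open U" and der: "\<And>p. p \<in> U \<Longrightarrow> (f has_derivative f' p) (at p)"
    and sm: "\<And>v. smooth_on U (\<lambda>p. f' p v)"
  shows "smooth_on U f"
proof -
  have fd: "frechet_derivative f (at p) v = f' p v" if "p \<in> U" for p v
    using frechet_derivative_at[OF der[OF that]] by simp
  have "Ck_on (Suc k) U f" for k
    unfolding Ck_on.simps
  proof (intro conjI ballI allI)
    show "f differentiable (at p)" if "p \<in> U" for p
      using der[OF that] by (auto simp: differentiable_def)
    show "Ck_on k U (\<lambda>p. frechet_derivative f (at p) v)" for v
      by (rule Ck_on_cong[OF \<open>open U\<close>, where g = "\<lambda>p. f' p v"])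
        (use sm[of v] fd in \<open>simp_all add: smooth_on_def\<close>)
  qed
  moreover from this have "Ck_on 0 U f"
    by (metis Ck_on_imp_continuous_on Ck_on.simps(1))
  ultimately have "Ck_on k U f" for k
    by (cases k) blast+
  then show ?thesis
    by (simp add: smooth_on_def)
qed

lemma Ck_on_add_scale:
  "open U \<Longrightarrow> Ck_on k U f \<Longrightarrow> Ck_on k U g \<Longrightarrow> Ck_on k U (\<lambda>p. f p + c * g p)"
proof (induction k arbitrary: f g)
  case 0
  then show ?case
    by (auto intro!: continuous_intros)
next
  case (Suc k)
  have der: "((\<lambda>p. f p + c * g p) has_derivative
      (\<lambda>v. frechet_derivative f (at p) v + c * frechet_derivative g (at p) v)) (at p)"
    if "p \<in> U" for p
    using Suc.prems(2,3) that
    by (auto intro!: derivative_intros simp: frechet_derivative_works)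
  have fd: "frechet_derivative (\<lambda>p. f p + c * g p) (at p) v =
      frechet_derivative f (at p) v + c * frechet_derivative g (at p) v"
    if "p \<in> U" for p v
    using frechet_derivative_at[OF der[OF that]] by metis
  have "Ck_on k U (\<lambda>p. frechet_derivative (\<lambda>p. f p + c * g p) (at p) v)" for v
    by (rule Ck_on_cong[OF Suc.prems(1), rotated], erule fd, rule Suc.IH[OF Suc.prems(1)])
      (use Suc.prems(2,3)[unfolded Ck_on.simps] in blast)+
  moreover have "(\<lambda>p. f p + c * g p) differentiable (at p)" if "p \<in> U" for p
    using der[OF that] by (auto simp: differentiable_def)
  ultimately show ?case
    by simp
qed

lemma smooth_on_add_scale:
  "open U \<Longrightarrow> smooth_on U f \<Longrightarrow> smooth_on U g \<Longrightarrow> smooth_on U (\<lambda>p. f p + c * g p)"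
  unfolding smooth_on_def using Ck_on_add_scale by blast

lemma open_CxH: "open CxH" and convex_CxH: "convex CxH"
proof -
  have eq: "CxH = UNIV \<times> {w. 0 < Im w}"
    by (auto simp: CxH_def)
  show "open CxH"
    unfolding eq by (intro open_Times open_UNIV open_halfspace_Im_gt)
  show "convex CxH"
    unfolding eq by (intro convex_Times convex_UNIV convex_halfspace_Im_gt)
qed

lemma mem_CxH: "p \<in> CxH \<longleftrightarrow> 0 < Im (snd p)"
  by (auto simp: CxH_def)

lemma has_derivative_Im_powr:
  assumes "p \<in> CxH"
  shows "((\<lambda>p. c * Im (snd p) powr m) has_derivative
    (\<lambda>v. (c * m * Im (snd v)) * Im (snd p) powr (m - 1))) (at p)"
proof -
  have pos: "0 < Im (snd p)"
    using assms by (simp add: mem_CxH)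
  have "((\<lambda>p. Im (snd p)) has_derivative (\<lambda>v. Im (snd v))) (at p)"
    by (auto intro!: derivative_eq_intros)
  from DERIV_compose_FDERIV[OF has_real_derivative_powr[OF pos] this, of m]
  have "((\<lambda>p. c * Im (snd p) powr m) has_derivative
      (\<lambda>v. c * (Im (snd v) * (m * Im (snd p) powr (m - 1))))) (at p)"
    by (rule has_derivative_mult_right)
  then show ?thesis
    by (simp add: mult_ac)
qed

text \<open>The multiples of real powers of \<open>Im w\<close> are closed under differentiation in constant
  directions.\<close>

lemma smooth_on_Im_powr: "smooth_on CxH (\<lambda>p. c * Im (snd p) powr m)"
  unfolding smooth_on_def
proof
  fix k
  show "Ck_on k CxH (\<lambda>p. c * Im (snd p) powr m)"
  proof (induction k arbitrary: c m)
    case 0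
    show ?case
      by (auto intro!: continuous_intros simp: mem_CxH)
  next
    case (Suc k)
    have fd: "frechet_derivative (\<lambda>p. c * Im (snd p) powr m) (at p) v =
        (c * m * Im (snd v)) * Im (snd p) powr (m - 1)" if "p \<in> CxH" for p v
      using frechet_derivative_at[OF has_derivative_Im_powr[OF that, of c m]] by metis
    have "Ck_on k CxH (\<lambda>p. frechet_derivative (\<lambda>p. c * Im (snd p) powr m) (at p) v)" for v
      by (rule Ck_on_cong[OF open_CxH, rotated], erule fd, rule Suc.IH)
    moreover have "(\<lambda>p. c * Im (snd p) powr m) differentiable (at p)" if "p \<in> CxH" for p
      using has_derivative_Im_powr[OF that] by (auto simp: differentiable_def)
    ultimately show ?case
      by simp
  qed
qed

section \<open>The Poincare lemma for one-forms on a convex open set\<close>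

text \<open>The potential is the integral of the form along the segment from a base point. Its
  derivative is computed under the integral sign; closedness turns the integrand into the
  \<open>t\<close>-derivative of \<open>t * \<eta> (p0 + t (p - p0)) v\<close>.\<close>

lemma closed_one_form_has_potential:
  fixes \<eta> :: form1
  assumes "open W" "convex W" "W \<noteq> {}"
    and lin: "\<And>p. p \<in> W \<Longrightarrow> linear (\<eta> p)"
    and sm: "\<And>v. smooth_on W (\<lambda>p. \<eta> p v)"
    and closed: "\<And>p u v. p \<in> W \<Longrightarrow> ext_d1 \<eta> p u v = 0"
  obtains F where "\<And>p. p \<in> W \<Longrightarrow> (F has_derivative \<eta> p) (at p)" "smooth_on W F"
proof -
  obtain p0 where p0: "p0 \<in> W"
    using \<open>W \<noteq> {}\<close> by blast
  define D where "D p v u = ext_d0 (\<lambda>x. \<eta> x v) p u" for p v u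
  have der: "((\<lambda>x. \<eta> x v) has_derivative D p v) (at p)" if "p \<in> W" for p v
    unfolding D_def by (rule smooth_on_has_derivative[OF sm that])
  have linD: "linear (D p v)" if "p \<in> W" for p v
    using der[OF that] has_derivative_linear by blast
  have sym: "D p v u = D p u v" if "p \<in> W" for p u v
    using closed[OF that, of u v] by (simp add: ext_d1_def D_def)
  have exp: "\<eta> p v = (\<Sum>b\<in>Basis. (v \<bullet> b) * \<eta> p b)" if "p \<in> W" for p v
  proof -
    have "\<eta> p v = \<eta> p (\<Sum>b\<in>Basis. (v \<bullet> b) *\<^sub>R b)"
      by (simp add: euclidean_representation)
    then show ?thesis
      using lin[OF that] by (simp add: linear_sum linear_scale)
  qed
  have expD: "D p v u = (\<Sum>b\<in>Basis. (v \<bullet> b) * D p b u)" if "p \<in> W" for p v u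
  proof -
    have "D p v u = D p u (\<Sum>b\<in>Basis. (v \<bullet> b) *\<^sub>R b)"
      using sym[OF that] by (simp add: euclidean_representation)
    also have "\<dots> = (\<Sum>b\<in>Basis. (v \<bullet> b) * D p u b)"
      using linD[OF that] by (simp add: linear_sum linear_scale)
    finally show ?thesis
      using sym[OF that] by simp
  qed
  define \<gamma> where "\<gamma> p t = p0 + t *\<^sub>R (p - p0)" for p and t :: real
  have \<gamma>W: "\<gamma> p t \<in> W" if "p \<in> W" "t \<in> cbox 0 1" for p t
  proof -
    have "\<gamma> p t = (1 - t) *\<^sub>R p0 + t *\<^sub>R p"
      by (simp add: \<gamma>_def algebra_simps)
    then show ?thesis
      using convexD_alt[OF \<open>convex W\<close> p0 that(1), of t] that(2) by simp
  qed
  define G where "G p t = \<eta> (\<gamma> p t) (p - p0)" for p t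
  define G' where "G' p t v = \<eta> (\<gamma> p t) v + t * D (\<gamma> p t) (p - p0) v" for p t v
  have cont\<gamma>: "continuous_on (W \<times> cbox 0 1) (\<lambda>x. \<gamma> (fst x) (snd x))"
    unfolding \<gamma>_def by (intro continuous_intros)
  have cont\<eta>: "continuous_on (W \<times> cbox 0 1) (\<lambda>x. \<eta> (\<gamma> (fst x) (snd x)) v)" for v
    by (rule continuous_on_compose2[OF smooth_on_imp_continuous_on[OF sm] cont\<gamma>]) (use \<gamma>W in auto)
  have contD: "continuous_on (W \<times> cbox 0 1) (\<lambda>x. D (\<gamma> (fst x) (snd x)) b v)" for b v
    unfolding D_def
    by (rule continuous_on_compose2[OF smooth_on_imp_continuous_on[OF smooth_on_ext_d0[OF sm]] cont\<gamma>])
      (use \<gamma>W in auto)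
  have contG': "continuous_on (W \<times> cbox 0 1) (\<lambda>x. G' (fst x) (snd x) v)" for v
  proof -
    have "continuous_on (W \<times> cbox 0 1) (\<lambda>x. \<eta> (\<gamma> (fst x) (snd x)) v +
        snd x * (\<Sum>b\<in>Basis. ((fst x - p0) \<bullet> b) * D (\<gamma> (fst x) (snd x)) b v))"
      by (intro continuous_intros cont\<eta> contD)
    then show ?thesis
      by (rule continuous_on_eq) (use \<gamma>W in \<open>auto simp: G'_def simp flip: expD\<close>)
  qed
  have linG': "bounded_linear (G' p t)" if "p \<in> W" "t \<in> cbox 0 1" for p t
  proof -
    have "linear (G' p t)"
      unfolding G'_def
      using lin[OF \<gamma>W[OF that]] linD[OF \<gamma>W[OF that], of "p - p0"]
      by (auto simp: linear_iff algebra_simps)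
    then show ?thesis
      by (rule linear_conv_bounded_linear[THEN iffD1])
  qed
  define B where "B p t = Blinfun (G' p t)" for p t
  have B: "blinfun_apply (B p t) = G' p t" if "p \<in> W" "t \<in> cbox 0 1" for p t
    unfolding B_def by (rule bounded_linear_Blinfun_apply[OF linG'[OF that]])
  have derG: "((\<lambda>p. G p t) has_derivative blinfun_apply (B p t)) (at p within W)"
    if pt: "p \<in> W" "t \<in> cbox 0 1" for p t
  proof -
    have d\<gamma>: "((\<lambda>p. \<gamma> p t) has_derivative (\<lambda>v. t *\<^sub>R v)) (at p)"
      unfolding \<gamma>_def by (auto intro!: derivative_eq_intros)
    have "((\<lambda>x. \<eta> (\<gamma> x t) b) has_derivative (\<lambda>v. t * D (\<gamma> p t) b v)) (at p)" for b
      using diff_chain_at[OF d\<gamma> der[OF \<gamma>W[OF pt], of b]] linear_scale[OF linD[OF \<gamma>W[OF pt]]]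
      by (simp add: o_def)
    then have "((\<lambda>x. \<Sum>b\<in>Basis. ((x - p0) \<bullet> b) * \<eta> (\<gamma> x t) b) has_derivative
       (\<lambda>v. \<Sum>b\<in>Basis. ((p - p0) \<bullet> b) * (t * D (\<gamma> p t) b v) + (v \<bullet> b) * \<eta> (\<gamma> p t) b)) (at p)"
      by (auto intro!: derivative_eq_intros)
    moreover have "(\<Sum>b\<in>Basis. ((p - p0) \<bullet> b) * (t * D (\<gamma> p t) b v) + (v \<bullet> b) * \<eta> (\<gamma> p t) b)
        = G' p t v" for v
      by (simp add: G'_def exp[OF \<gamma>W[OF pt], of v] expD[OF \<gamma>W[OF pt], of "p - p0"]
          sum.distrib sum_distrib_left mult_ac)
    ultimately have "((\<lambda>x. \<Sum>b\<in>Basis. ((x - p0) \<bullet> b) * \<eta> (\<gamma> x t) b) has_derivative G' p t) (at p within W)"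
      by (simp add: has_derivative_at_withinI)
    then have "((\<lambda>x. G x t) has_derivative G' p t) (at p within W)"
      by (rule has_derivative_transform[OF pt(1), rotated])
        (use exp \<gamma>W pt in \<open>auto simp: G_def\<close>)
    then show ?thesis
      using B[OF pt] by simp
  qed
  have contB: "continuous_on (W \<times> cbox 0 1) (\<lambda>(p, t). B p t)"
    by (rule continuous_on_blinfun_componentwise, rule continuous_on_eq[OF contG'])
      (use B in auto)
  have contPair: "continuous_on (cbox 0 1) (\<lambda>t::real. (p, t))" for p :: C2
    by (intro continuous_intros)
  have intG: "G p integrable_on cbox 0 1" if "p \<in> W" for p
  proof (rule integrable_continuous)
    have "continuous_on (cbox 0 1) (\<lambda>t. \<eta> (\<gamma> p t) v)" for v
      using continuous_on_compose2[OF cont\<eta>[of v] contPair[of p]] that by auto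
    then show "continuous_on (cbox 0 1) (G p)"
      unfolding G_def .
  qed
  define F where "F p = integral (cbox 0 1) (G p)" for p
  have derF: "(F has_derivative \<eta> p) (at p)" if "p \<in> W" for p
  proof -
    have "(F has_derivative blinfun_apply (integral (cbox 0 1) (B p))) (at p within W)"
      unfolding F_def
      by (rule leibniz_rule[OF derG intG contB that \<open>convex W\<close>])
    moreover have "blinfun_apply (integral (cbox 0 1) (B p)) v = \<eta> p v" for v
    proof -
      have "continuous_on (cbox 0 1) (B p)"
        using continuous_on_compose2[OF contB contPair[of p]] that by auto
      then have "B p integrable_on cbox 0 1"
        by (rule integrable_continuous)
      then have "blinfun_apply (integral (cbox 0 1) (B p)) v =
          integral (cbox 0 1) (\<lambda>t. blinfun_apply (B p t) v)"
        by (rule blinfun_apply_integral)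
      also have "\<dots> = integral (cbox 0 1) (\<lambda>t. G' p t v)"
        by (rule integral_cong) (use B[OF that] in simp)
      also have "\<dots> = 1 * \<eta> (\<gamma> p 1) v - 0 * \<eta> (\<gamma> p 0) v"
      proof (rule integral_unique)
        have "((\<lambda>t. t * \<eta> (\<gamma> p t) v) has_vector_derivative G' p t v) (at t within {0..1})"
          if t: "t \<in> {0..1}" for t
        proof -
          have "((\<lambda>t. \<gamma> p t) has_derivative (\<lambda>h. h *\<^sub>R (p - p0))) (at t)"
            unfolding \<gamma>_def by (auto intro!: derivative_eq_intros)
          from diff_chain_at[OF this der, of v]
          have "((\<lambda>t. \<eta> (\<gamma> p t) v) has_derivative (\<lambda>h. D (\<gamma> p t) v (h *\<^sub>R (p - p0)))) (at t)"
            using \<gamma>W[OF \<open>p \<in> W\<close>] t by (simp add: o_def)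
          then have "((\<lambda>t. \<eta> (\<gamma> p t) v) has_derivative (\<lambda>h. h * D (\<gamma> p t) (p - p0) v)) (at t)"
            using sym[OF \<gamma>W[OF \<open>p \<in> W\<close>]] linear_scale[OF linD[OF \<gamma>W[OF \<open>p \<in> W\<close>]]] t by simp
          then have "((\<lambda>t. t * \<eta> (\<gamma> p t) v) has_derivative (\<lambda>h. h * G' p t v)) (at t)"
            by (auto intro!: derivative_eq_intros simp: G'_def algebra_simps)
          then show ?thesis
            by (simp add: has_vector_derivative_def has_derivative_at_withinI)
        qed
        then show "((\<lambda>t. G' p t v) has_integral 1 * \<eta> (\<gamma> p 1) v - 0 * \<eta> (\<gamma> p 0) v) (cbox 0 1)"
          using fundamental_theorem_of_calculus[of 0 1 "\<lambda>t. t * \<eta> (\<gamma> p t) v" "\<lambda>t. G' p t v"] by simp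
      qed
      finally show ?thesis
        by (simp add: \<gamma>_def)
    qed
    then have "blinfun_apply (integral (cbox 0 1) (B p)) = \<eta> p"
      by blast
    ultimately show ?thesis
      using at_within_open[OF that \<open>open W\<close>] by simp
  qed
  show thesis
    by (rule that[OF derF smooth_on_if_derivative[OF \<open>open W\<close> derF sm]])
qed

section \<open>Linear algebra of the defining matrix\<close>

lemma int_matrix_inverse_3:
  fixes A :: "int^3^3"
  assumes "det A = 1"
  obtains B :: "int^3^3" where "A ** B = mat 1" "B ** A = mat 1"
proof -
  \<comment> \<open>The adjugate matrix.\<close>
  define B :: "int^3^3" where "B = vector [
    vector [A$2$2 * A$3$3 - A$2$3 * A$3$2, A$1$3 * A$3$2 - A$1$2 * A$3$3, A$1$2 * A$2$3 - A$1$3 * A$2$2],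
    vector [A$2$3 * A$3$1 - A$2$1 * A$3$3, A$1$1 * A$3$3 - A$1$3 * A$3$1, A$1$3 * A$2$1 - A$1$1 * A$2$3],
    vector [A$2$1 * A$3$2 - A$2$2 * A$3$1, A$1$2 * A$3$1 - A$1$1 * A$3$2, A$1$1 * A$2$2 - A$1$2 * A$2$1]]"
  have d: "A$1$1 * A$2$2 * A$3$3 + A$1$2 * A$2$3 * A$3$1 + A$1$3 * A$2$1 * A$3$2 -
    A$1$1 * A$2$3 * A$3$2 - A$1$2 * A$2$1 * A$3$3 - A$1$3 * A$2$2 * A$3$1 = 1"
    using assms by (simp add: det_3)
  have "A ** B = mat 1"
    unfolding vec_eq_iff forall_3 matrix_matrix_mult_def mat_def sum_3 B_def
    using d by (simp add: algebra_simps)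
  moreover have "B ** A = mat 1"
    unfolding vec_eq_iff forall_3 matrix_matrix_mult_def mat_def sum_3 B_def
    using d by (simp add: algebra_simps)
  ultimately show thesis
    by (rule that)
qed

lemma BijGroup_simps:
  "carrier (BijGroup S) = Bij S"
  "f \<in> Bij S \<Longrightarrow> g \<in> Bij S \<Longrightarrow> f \<otimes>\<^bsub>BijGroup S\<^esub> g = compose S f g"
  "\<one>\<^bsub>BijGroup S\<^esub> = (\<lambda>x\<in>S. x)"
  by (simp_all add: BijGroup_def)

locale inoue_data =
  fixes A :: "int^3^3" and \<alpha> :: real and \<beta> :: complex and a :: "real^3" and b :: "complex^3"
  assumes data: "inoue_S0_data A \<alpha> \<beta> a b"
begin

lemma alpha_gt_1: "\<alpha> > 1"
  using data by (simp add: inoue_S0_data_def)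

lemma beta_nonreal: "cnj \<beta> \<noteq> \<beta>"
  using data by (auto simp: inoue_S0_data_def Reals_cnj_iff)

lemma beta_ne_alpha: "\<beta> \<noteq> of_real \<alpha>" and cnj_beta_ne_alpha: "cnj \<beta> \<noteq> of_real \<alpha>"
  and beta_ne_1: "\<beta> \<noteq> 1" and cnj_beta_ne_1: "cnj \<beta> \<noteq> 1"
  using beta_nonreal by (metis complex_cnj_complex_of_real complex_cnj_cnj complex_cnj_one)+

lemma eigen_a: "(\<Sum>j\<in>UNIV. of_int (A$i$j) * a$j) = \<alpha> * a$i"
  using data by (auto simp: inoue_S0_data_def vec_eq_iff matrix_vector_mult_def)

lemma eigen_b: "(\<Sum>j\<in>UNIV. of_int (A$i$j) * b$j) = \<beta> * b$i"
  using data by (auto simp: inoue_S0_data_def vec_eq_iff matrix_vector_mult_def)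

lemma eigen_a_complex: "(\<Sum>j\<in>UNIV. of_int (A$i$j) * complex_of_real (a$j)) = of_real \<alpha> * of_real (a$i)"
  using arg_cong[OF eigen_a[of i], of complex_of_real] by simp

lemma eigen_cnj_b: "(\<Sum>j\<in>UNIV. of_int (A$i$j) * cnj (b$j)) = cnj \<beta> * cnj (b$i)"
  using arg_cong[OF eigen_b[of i], of cnj] by simp

definition eigvecs :: "complex^3^3" where
  "eigvecs = (\<chi> i. vector [of_real (a$i), b$i, cnj (b$i)])"

definition eigvals :: "complex^3" where
  "eigvals = vector [of_real \<alpha>, \<beta>, cnj \<beta>]"

lemma eigvecs_nth:
  "eigvecs$i$1 = of_real (a$i)" "eigvecs$i$2 = b$i" "eigvecs$i$3 = cnj (b$i)"
  by (simp_all add: eigvecs_def)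

lemma eigvals_nth: "eigvals$1 = of_real \<alpha>" "eigvals$2 = \<beta>" "eigvals$3 = cnj \<beta>"
  by (simp_all add: eigvals_def)

lemma eigen: "(\<Sum>j\<in>UNIV. of_int (A$i$j) * eigvecs$j$r) = eigvals$r * eigvecs$i$r"
  using exhaust_3[of r] eigen_a_complex[of i] eigen_b[of i] eigen_cnj_b[of i]
  by (auto simp: eigvecs_nth eigvals_nth)

lemma eigvals_distinct: "r \<noteq> s \<Longrightarrow> eigvals$r \<noteq> eigvals$s"
  using exhaust_3[of r] exhaust_3[of s] beta_nonreal beta_ne_alpha cnj_beta_ne_alpha
  by (auto simp: eigvals_nth)

lemma eigvals_ne_1: "eigvals$r \<noteq> 1"
  using exhaust_3[of r] alpha_gt_1 beta_ne_1 cnj_beta_ne_1 by (auto simp: eigvals_nth)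

text \<open>Eigenvectors for distinct eigenvalues are independent: apply \<open>A\<close> twice to a linear relation and
  invert the Vandermonde matrix of the eigenvalues.\<close>

lemma eigvecs_ker:
  assumes "eigvecs *v x = 0"
  shows "x = 0"
proof -
  define X where "X i r = x$r * eigvecs$i$r" for i r
  have step: "(\<Sum>r\<in>UNIV. eigvals$r * y r * X i r) = 0"
    if "\<And>i. (\<Sum>r\<in>UNIV. y r * X i r) = 0" for y i
  proof -
    have "(\<Sum>r\<in>UNIV. eigvals$r * y r * X i r) =
        (\<Sum>r\<in>UNIV. \<Sum>j\<in>UNIV. of_int (A$i$j) * (y r * X j r))"
    proof (rule sum.cong[OF refl])
      fix r :: 3
      show "eigvals$r * y r * X i r = (\<Sum>j\<in>UNIV. of_int (A$i$j) * (y r * X j r))"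
        using arg_cong[OF eigen[of i r], of "\<lambda>t. y r * x$r * t"]
        by (simp add: X_def sum_distrib_left mult_ac)
    qed
    also have "\<dots> = (\<Sum>j\<in>UNIV. of_int (A$i$j) * (\<Sum>r\<in>UNIV. y r * X j r))"
      by (subst sum.swap) (simp add: sum_distrib_left)
    finally show ?thesis
      by (simp add: that)
  qed
  have E0: "(\<Sum>r\<in>UNIV. 1 * X i r) = 0" for i
    using assms by (simp add: vec_eq_iff matrix_vector_mult_def X_def mult.commute)
  note E1 = step[OF E0]
  note E2 = step[OF E1]
  let ?l = "\<lambda>r. eigvals$r"
  have X0: "X i r = 0" for i r
  proof -
    have eqs: "X i 1 + X i 2 + X i 3 = 0"
      "?l 1 * X i 1 + ?l 2 * X i 2 + ?l 3 * X i 3 = 0"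
      "?l 1 * ?l 1 * X i 1 + ?l 2 * ?l 2 * X i 2 + ?l 3 * ?l 3 * X i 3 = 0"
      using E0[of i] E1[of i] E2[of i] by (simp_all add: sum_3)
    have "(?l 1 - ?l 2) * (?l 1 - ?l 3) * X i 1 = 0"
      "(?l 2 - ?l 1) * (?l 2 - ?l 3) * X i 2 = 0"
      "(?l 3 - ?l 1) * (?l 3 - ?l 2) * X i 3 = 0"
      using eqs by algebra+
    moreover have "?l 1 \<noteq> ?l 2" "?l 1 \<noteq> ?l 3" "?l 2 \<noteq> ?l 3"
      by (simp_all add: eigvals_distinct)
    ultimately show ?thesis
      using exhaust_3[of r] by auto
  qed
  have "\<exists>i. eigvecs$i$r \<noteq> 0" for r
    using data exhaust_3[of r] by (auto simp: inoue_S0_data_def vec_eq_iff eigvecs_nth)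
  then have "x$r = 0" for r
    using X0 unfolding X_def by (metis mult_eq_0_iff)
  then show ?thesis
    by (simp add: vec_eq_iff)
qed

lemma eigvecs_inverse:
  obtains Q where "eigvecs ** Q = mat 1" "Q ** eigvecs = mat 1"
  using eigvecs_ker matrix_left_invertible_ker[of eigvecs] matrix_left_right_inverse by blast

text \<open>The product of the three eigenvalues is the determinant of \<open>A\<close>; so \<open>Im w |dz|^2\<close> is
  invariant under the dilation.\<close>

lemma alpha_norm_beta: "\<alpha> * (cmod \<beta>)\<^sup>2 = 1"
proof -
  define D :: "complex^3^3" where "D = (\<chi> i j. if i = j then eigvals$i else 0)"
  have "map_matrix of_int A ** eigvecs = eigvecs ** D"
    unfolding vec_eq_iff matrix_matrix_mult_def
    by (simp add: eigen D_def if_distrib sum.delta' mult.commute cong: if_cong)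
  then have "det (map_matrix of_int A :: complex^3^3) * det eigvecs = det eigvecs * det D"
    by (metis det_mul)
  moreover have "det eigvecs \<noteq> 0"
    using eigvecs_inverse invertible_det_nz unfolding invertible_def by metis
  moreover have "det (map_matrix of_int A :: complex^3^3) = of_int (det A)"
    by (simp add: det_3)
  ultimately have "det D = 1"
    using data by (simp add: inoue_S0_data_def)
  then have "of_real \<alpha> * \<beta> * cnj \<beta> = 1"
    by (simp add: det_3 D_def eigvals_nth)
  then have "complex_of_real (\<alpha> * (cmod \<beta>)\<^sup>2) = of_real 1"
    using complex_norm_square[of \<beta>] by (simp add: mult.assoc)
  then show ?thesis
    using of_real_eq_iff by blast
qed

lemma beta_nonzero: "\<beta> \<noteq> 0"
  using alpha_norm_beta by auto

lemma eigenvector_1_eq_0: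
  fixes c :: "real^3"
  assumes "\<And>i. (\<Sum>j\<in>UNIV. of_int (A$i$j) * c$j) = c$i"
  shows "c = 0"
proof -
  obtain Q where Q: "eigvecs ** Q = mat 1"
    using eigvecs_inverse by blast
  define y where "y = Q *v (\<chi> i. complex_of_real (c$i))"
  have "eigvecs *v y = (\<chi> i. complex_of_real (c$i))"
    by (simp add: y_def matrix_vector_mul_assoc Q)
  then have cy: "(\<Sum>r\<in>UNIV. eigvecs$i$r * y$r) = of_real (c$i)" for i
    by (simp add: vec_eq_iff matrix_vector_mult_def)
  have "(\<Sum>r\<in>UNIV. eigvecs$i$r * (eigvals$r * y$r)) = of_real (c$i)" for i
  proof -
    have "(\<Sum>r\<in>UNIV. eigvecs$i$r * (eigvals$r * y$r)) =
        (\<Sum>r\<in>UNIV. \<Sum>j\<in>UNIV. of_int (A$i$j) * (eigvecs$j$r * y$r))"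
    proof (rule sum.cong[OF refl])
      fix r :: 3
      show "eigvecs$i$r * (eigvals$r * y$r) = (\<Sum>j\<in>UNIV. of_int (A$i$j) * (eigvecs$j$r * y$r))"
        using arg_cong[OF eigen[of i r], of "\<lambda>t. y$r * t"]
        by (simp add: sum_distrib_left mult_ac)
    qed
    also have "\<dots> = (\<Sum>j\<in>UNIV. of_int (A$i$j) * of_real (c$j))"
      by (subst sum.swap) (simp add: sum_distrib_left[symmetric] cy)
    also have "\<dots> = of_real (c$i)"
      using arg_cong[OF assms[of i], of complex_of_real] by simp
    finally show ?thesis .
  qed
  then have "eigvecs *v (\<chi> r. eigvals$r * y$r - y$r) = 0"
    using cy by (simp add: vec_eq_iff matrix_vector_mult_def right_diff_distrib sum_subtractf)
  then have "(\<chi> r. eigvals$r * y$r - y$r) = 0"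
    by (rule eigvecs_ker)
  then have "(eigvals$r - 1) * y$r = 0" for r
    by (simp add: vec_eq_iff left_diff_distrib)
  then have "y$r = 0" for r
    using eigvals_ne_1 by auto
  then have "complex_of_real (c$i) = 0" for i
    using cy[of i] by simp
  then show ?thesis
    by (simp add: vec_eq_iff)
qed

section \<open>The translation lattice and the group\<close>

definition e :: "3 \<Rightarrow> C2" where
  "e i = (b$i, of_real (a$i))"

definition lat :: "real^3 \<Rightarrow> C2" where
  "lat u = (\<Sum>i\<in>UNIV. u$i *\<^sub>R e i)"

definition real_vec :: "int^3 \<Rightarrow> real^3" where
  "real_vec k = (\<chi> i. of_int (k$i))"

definition dil :: "int \<Rightarrow> C2 \<Rightarrow> C2" where
  "dil n p = (\<beta> powi n * fst p, of_real (\<alpha> powi n) * snd p)"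

lemma linear_lat: "linear lat"
  unfolding lat_def by (rule linearI) (simp_all add: algebra_simps sum.distrib scaleR_sum_right)

lemma lat_simps: "lat (u + v) = lat u + lat v" "lat (c *\<^sub>R u) = c *\<^sub>R lat u" "lat 0 = 0"
  "lat (- u) = - lat u" "lat (u - v) = lat u - lat v"
  using linear_lat by (simp_all add: linear_add linear_scale linear_0 linear_neg linear_diff)

lemma fst_lat: "fst (lat u) = (\<Sum>i\<in>UNIV. of_real (u$i) * b$i)"
  and snd_lat: "snd (lat u) = of_real (\<Sum>i\<in>UNIV. u$i * a$i)"
  by (simp_all add: lat_def fst_sum snd_sum e_def scaleR_conv_of_real)

lemma Im_snd_lat: "Im (snd (lat u)) = 0"
  by (simp add: snd_lat)

lemma real_vec_simps: "real_vec (k + l) = real_vec k + real_vec l" "real_vec 0 = 0" "real_vec (- k) = - real_vec k"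
  by (simp_all add: real_vec_def vec_eq_iff)

lemma lat_axis: "lat (axis i c) = c *\<^sub>R e i"
  by (simp add: lat_def axis_def if_distrib[of "\<lambda>x. x *\<^sub>R _"] cong: if_cong)

lemma real_vec_axis: "real_vec (axis i 1) = axis i 1"
  by (simp add: real_vec_def axis_def vec_eq_iff)

lemma linear_dil: "linear (dil n)"
  unfolding dil_def by (rule linearI) (auto simp: algebra_simps scaleR_conv_of_real)

lemma dil_simps: "dil n (p + q) = dil n p + dil n q" "dil n (c *\<^sub>R p) = c *\<^sub>R dil n p"
  "dil n (- p) = - dil n p" "dil n (p - q) = dil n p - dil n q" "dil n 0 = 0"
  using linear_dil[of n] by (simp_all add: linear_add linear_scale linear_0 linear_neg linear_diff)

lemma dil_0: "dil 0 p = p"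
  by (simp add: dil_def)

lemma dil_1: "dil 1 p = (\<beta> * fst p, of_real \<alpha> * snd p)"
  by (simp add: dil_def)

lemma dil_dil: "dil m (dil n p) = dil (m + n) p"
  using beta_nonzero alpha_gt_1 by (simp add: dil_def power_int_add)

lemma Im_snd_dil: "Im (snd (dil n p)) = \<alpha> powi n * Im (snd p)"
  by (simp add: dil_def del: of_real_power_int)

lemma dil_mem_CxH: "p \<in> CxH \<Longrightarrow> dil n p \<in> CxH"
  using alpha_gt_1 by (simp add: Im_snd_dil mem_CxH)

lemma translate_mem_CxH: "p \<in> CxH \<Longrightarrow> p + lat u \<in> CxH"
  by (simp add: mem_CxH Im_snd_lat)

lemma dil_e: "dil 1 (e i) = (\<Sum>j\<in>UNIV. of_int (A$i$j) *\<^sub>R e j)"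
proof -
  have "of_real \<alpha> * complex_of_real (a$i) = (\<Sum>j\<in>UNIV. of_int (A$i$j) * complex_of_real (a$j))"
    using eigen_a_complex[of i] by simp
  then show ?thesis
    using eigen_b[of i] by (simp add: dil_1 e_def prod_eq_iff fst_sum snd_sum scaleR_conv_of_real)
qed

lemma dil_lat: "dil 1 (lat u) = lat (u v* map_matrix of_int A)"
proof -
  have "dil 1 (lat u) = (\<Sum>i\<in>UNIV. u$i *\<^sub>R (\<Sum>j\<in>UNIV. of_int (A$i$j) *\<^sub>R e j))"
    unfolding lat_def using linear_dil[of 1] by (simp add: linear_sum linear_scale dil_e)
  also have "\<dots> = (\<Sum>j\<in>UNIV. \<Sum>i\<in>UNIV. (u$i * of_int (A$i$j)) *\<^sub>R e j)"
    by (subst sum.swap) (simp add: scaleR_sum_right)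
  finally show ?thesis
    by (simp add: lat_def vector_matrix_mult_def scaleR_sum_left)
qed

lemma real_vec_vector_matrix_mult: "real_vec k v* map_matrix of_int M = real_vec (k v* M)"
  by (simp add: real_vec_def vector_matrix_mult_def vec_eq_iff)

lemma dil_lat_real_vec: "dil 1 (lat (real_vec k)) = lat (real_vec (k v* A))"
  by (simp add: dil_lat real_vec_vector_matrix_mult)

lemma lat_eq_0: "lat u = 0 \<Longrightarrow> u = 0"
proof -
  assume u: "lat u = 0"
  define U :: "complex^3" where "U = (\<chi> i. of_real (u$i))"
  have ub: "(\<Sum>i\<in>UNIV. of_real (u$i) * b$i) = 0"
    using fst_lat[of u] u by simp
  have uc: "(\<Sum>i\<in>UNIV. of_real (u$i) * cnj (b$i)) = 0"
    using arg_cong[OF ub, of cnj] by simp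
  have ua: "(\<Sum>i\<in>UNIV. of_real (u$i) * complex_of_real (a$i)) = 0"
    using snd_lat[of u] u by simp
  have "U v* eigvecs = 0"
    unfolding vec_eq_iff forall_3 using ua ub uc
    by (simp add: vector_matrix_mult_def U_def eigvecs_nth)
  moreover obtain Q where "eigvecs ** Q = mat 1"
    using eigvecs_inverse by blast
  ultimately have "U = 0"
    by (metis vector_matrix_mul_assoc vector_matrix_mul_rid vector_matrix_mult_0)
  then show "u = 0"
    by (simp add: U_def vec_eq_iff)
qed

lemma lat_surj: obtains u where "lat u = (\<zeta>, 0)"
proof -
  obtain Q where Q: "Q ** eigvecs = mat 1"
    using eigvecs_inverse by blast
  define y where "y = vector [0, \<zeta>, cnj \<zeta>] v* Q"
  have "y v* eigvecs = vector [0, \<zeta>, cnj \<zeta>]"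
    by (simp add: y_def vector_matrix_mul_assoc Q)
  then have y: "(\<Sum>i\<in>UNIV. y$i * of_real (a$i)) = 0" "(\<Sum>i\<in>UNIV. y$i * b$i) = \<zeta>"
    "(\<Sum>i\<in>UNIV. y$i * cnj (b$i)) = cnj \<zeta>"
    by (simp_all add: vec_eq_iff forall_3 vector_matrix_mult_def eigvecs_nth)
  \<comment> \<open>The conjugate of \<open>y\<close> solves the same linear system, hence so does its real part.\<close>
  define u :: "real^3" where "u = (\<chi> i. Re (y$i))"
  have u: "complex_of_real (u$i) = (y$i + cnj (y$i)) / 2" for i
    by (simp add: u_def complex_add_cnj)
  have "fst (lat u) = ((\<Sum>i\<in>UNIV. y$i * b$i) + cnj (\<Sum>i\<in>UNIV. y$i * cnj (b$i))) / 2"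
    by (simp add: fst_lat u sum.distrib[symmetric] sum_divide_distrib algebra_simps)
  moreover have "(\<Sum>i\<in>UNIV. u$i * a$i) = Re (\<Sum>i\<in>UNIV. y$i * of_real (a$i))"
    by (simp add: u_def)
  ultimately have "lat u = (\<zeta>, 0)"
    using y by (simp add: prod_eq_iff snd_lat)
  then show thesis
    by (rule that)
qed

definition lattice :: "C2 set" where
  "lattice = range (\<lambda>k. lat (real_vec k))"

lemma lat_mem_lattice: "lat (real_vec k) \<in> lattice"
  by (simp add: lattice_def)

lemma lattice_closed: "l \<in> lattice \<Longrightarrow> l' \<in> lattice \<Longrightarrow> l + l' \<in> lattice" "l \<in> lattice \<Longrightarrow> - l \<in> lattice" "0 \<in> lattice"
proof -
  show "l \<in> lattice \<Longrightarrow> l' \<in> lattice \<Longrightarrow> l + l' \<in> lattice"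
    unfolding lattice_def by (auto simp flip: real_vec_simps lat_simps)
  show "l \<in> lattice \<Longrightarrow> - l \<in> lattice"
    unfolding lattice_def by (auto simp flip: real_vec_simps lat_simps)
  show "0 \<in> lattice"
    using lat_mem_lattice[of 0] by (simp add: real_vec_simps lat_simps)
qed

lemma dil_lattice: "l \<in> lattice \<Longrightarrow> dil n l \<in> lattice"
proof -
  obtain B where B: "B ** A = mat 1"
    using int_matrix_inverse_3[of A] data unfolding inoue_S0_data_def by metis
  have up: "dil 1 l \<in> lattice" if "l \<in> lattice" for l
    using that dil_lat_real_vec by (auto simp: lattice_def)
  have down: "dil (-1) l \<in> lattice" if "l \<in> lattice" for l
  proof -
    obtain k where "l = lat (real_vec k)"
      using \<open>l \<in> lattice\<close> by (auto simp: lattice_def)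
    also have "\<dots> = dil 1 (lat (real_vec (k v* B)))"
      by (simp add: dil_lat_real_vec vector_matrix_mul_assoc B)
    finally have "dil (-1) l = lat (real_vec (k v* B))"
      by (simp add: dil_dil dil_0)
    then show ?thesis
      by (simp add: lat_mem_lattice)
  qed
  show "l \<in> lattice \<Longrightarrow> dil n l \<in> lattice"
  proof (induction n rule: int_induct[where k = 0])
    case (step1 n)
    then show ?case
      using up[of "dil n l"] by (simp add: dil_dil add.commute)
  next
    case (step2 n)
    then show ?case
      using down[of "dil n l"] by (simp add: dil_dil)
  qed (simp add: dil_0)
qed

definition G :: "(C2 \<Rightarrow> C2) set" where
  "G = inoue_group \<alpha> \<beta> a b"

definition gens :: "(C2 \<Rightarrow> C2) set" where
  "gens = insert (restrict (dil 1) CxH) (range (\<lambda>i. restrict (\<lambda>p. p + e i) CxH))"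

lemma G_eq: "G = generate (BijGroup CxH) gens"
proof -
  have 1: "(\<lambda>(z, w)\<in>CxH. (\<beta> * z, of_real \<alpha> * w)) = restrict (dil 1) CxH"
    by (auto simp: fun_eq_iff restrict_def dil_1)
  have 2: "(\<lambda>(z, w)\<in>CxH. (z + b $ i, w + of_real (a $ i))) = restrict (\<lambda>p. p + e i) CxH" for i
    by (auto simp: fun_eq_iff restrict_def e_def)
  show ?thesis
    unfolding G_def inoue_group_def gens_def 1 2 by (simp add: full_SetCompr_eq)
qed

lemma dil_add_Bij: "restrict (\<lambda>p. dil n p + lat u) CxH \<in> Bij CxH"
proof -
  have "bij_betw (\<lambda>p. dil n p + lat u) CxH CxH"
  proof (rule bij_betw_byWitness[where f' = "\<lambda>p. dil (-n) (p - lat u)"])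
    show "(\<lambda>p. dil n p + lat u) ` CxH \<subseteq> CxH"
      using translate_mem_CxH dil_mem_CxH by blast
    have "p - lat u \<in> CxH" if "p \<in> CxH" for p
      using translate_mem_CxH[OF that, of "- u"] by (simp add: lat_simps)
    then show "(\<lambda>p. dil (-n) (p - lat u)) ` CxH \<subseteq> CxH"
      using dil_mem_CxH by blast
  qed (simp_all add: dil_simps dil_dil dil_0)
  then show ?thesis
    by (simp add: Bij_def cong: bij_betw_cong)
qed

lemma e_eq_lat: "e i = lat (real_vec (axis i 1))"
  by (simp add: real_vec_axis lat_axis)

lemma gens_form: "g \<in> gens \<Longrightarrow> \<exists>n. \<exists>l\<in>lattice. g = restrict (\<lambda>p. dil n p + l) CxH"
proof -
  assume "g \<in> gens"
  then consider "g = restrict (dil 1) CxH" | i where "g = restrict (\<lambda>p. p + e i) CxH"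
    unfolding gens_def by blast
  then show ?thesis
  proof cases
    case 1
    then show ?thesis
      using lattice_closed(3) by (intro exI[of _ 1] bexI[of _ 0]) simp_all
  next
    case 2
    then show ?thesis
      using lat_mem_lattice[of "axis i 1"]
      by (intro exI[of _ 0] bexI[of _ "e i"]) (simp_all add: dil_0 e_eq_lat)
  qed
qed

lemma gens_carrier: "gens \<subseteq> carrier (BijGroup CxH)"
proof
  fix g assume "g \<in> gens"
  then obtain n l where "l \<in> lattice" "g = restrict (\<lambda>p. dil n p + l) CxH"
    using gens_form by blast
  then show "g \<in> carrier (BijGroup CxH)"
    using dil_add_Bij by (auto simp: lattice_def BijGroup_simps)
qed

lemma G_Bij: "g \<in> G \<Longrightarrow> g \<in> Bij CxH"
  using group.generate_in_carrier[OF group_BijGroup gens_carrier] BijGroup_simps(1)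
  unfolding G_eq by blast

lemma G_maps: "g \<in> G \<Longrightarrow> p \<in> CxH \<Longrightarrow> g p \<in> CxH"
  using G_Bij Bij_imp_funcset by blast

lemma G_one: "restrict (\<lambda>p. p) CxH \<in> G"
  using generate.one[of "BijGroup CxH" gens] by (simp add: G_eq BijGroup_simps)

lemma G_comp:
  assumes "g \<in> G" "h \<in> G"
  shows "compose CxH g h \<in> G"
proof -
  have "g \<otimes>\<^bsub>BijGroup CxH\<^esub> h \<in> G"
    using generate.eng assms unfolding G_eq .
  then show ?thesis
    using G_Bij[OF assms(1)] G_Bij[OF assms(2)] by (simp add: BijGroup_simps)
qed

lemma G_inv:
  assumes "g \<in> G"
  shows "restrict (inv_into CxH g) CxH \<in> G"
proof -
  have "inv\<^bsub>BijGroup CxH\<^esub> g \<in> G"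
    using group.generate_m_inv_closed[OF group_BijGroup gens_carrier] assms unfolding G_eq .
  then show ?thesis
    using inv_BijGroup[OF G_Bij[OF assms]] by simp
qed

lemma G_inv_apply:
  assumes "g \<in> Bij CxH" "p \<in> CxH"
  shows "inv_into CxH g (g p) = p" "g (inv_into CxH g p) = p" "inv_into CxH g p \<in> CxH"
  using assms by (auto simp: Bij_def bij_betw_def inv_into_f_f f_inv_into_f inv_into_into)

text \<open>The lattice \<open>lattice\<close> is normalised by the dilations, so the products of a dilation with a lattice
  translation form a group.\<close>

lemma G_form: "g \<in> G \<Longrightarrow> \<exists>n. \<exists>l\<in>lattice. \<forall>p\<in>CxH. g p = dil n p + l"
  unfolding G_eq
proof (induction rule: generate.induct)
  case one
  show ?case
    using lattice_closed(3) by (intro exI[of _ 0] bexI[of _ 0]) (auto simp: BijGroup_simps dil_0)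
next
  case (incl h)
  then show ?case
    using gens_form by fastforce
next
  case (inv h)
  then have h: "h \<in> Bij CxH"
    using gens_carrier by (auto simp: BijGroup_simps)
  obtain n l where l: "l \<in> lattice" "\<forall>p\<in>CxH. h p = dil n p + l"
    using gens_form[OF inv] by fastforce
  have "(inv\<^bsub>BijGroup CxH\<^esub> h) p = dil (-n) p + dil (-n) (- l)" if p: "p \<in> CxH" for p
  proof -
    define q where "q = inv_into CxH h p"
    have "p = dil n q + l"
      using G_inv_apply[OF h p] l by (simp add: q_def)
    then have "dil (-n) p + dil (-n) (- l) = q"
      by (simp add: dil_simps dil_dil dil_0)
    then show ?thesis
      using p by (simp add: inv_BijGroup[OF h] q_def)
  qed
  then show ?case
    using dil_lattice lattice_closed(2) l(1) by blast
next
  case (eng g h)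
  then obtain m k n l where k: "k \<in> lattice" "\<forall>p\<in>CxH. g p = dil m p + k"
    and l: "l \<in> lattice" "\<forall>p\<in>CxH. h p = dil n p + l"
    by blast
  have "g \<in> G" "h \<in> G"
    using eng by (simp_all add: G_eq)
  then have "(g \<otimes>\<^bsub>BijGroup CxH\<^esub> h) p = dil (m + n) p + (dil m l + k)" if "p \<in> CxH" for p
    using that G_Bij G_maps[of h p] k l by (simp add: BijGroup_simps compose_def dil_simps dil_dil)
  moreover have "dil m l + k \<in> lattice"
    using k l dil_lattice lattice_closed(1) by blast
  ultimately show ?case
    by blast
qed

lemma G_invariant:
  fixes \<Phi> :: "C2 \<Rightarrow> 'x"
  assumes dil: "\<And>p. p \<in> CxH \<Longrightarrow> \<Phi> (dil 1 p) = \<Phi> p"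
    and trans: "\<And>i p. p \<in> CxH \<Longrightarrow> \<Phi> (p + e i) = \<Phi> p"
    and "g \<in> G" "p \<in> CxH"
  shows "\<Phi> (g p) = \<Phi> p"
proof -
  have gens: "\<Phi> (h p) = \<Phi> p" if "h \<in> gens" "p \<in> CxH" for h p
    using that(1) unfolding gens_def by (auto simp: dil[OF that(2)] trans[OF that(2)] that(2))
  from \<open>g \<in> G\<close> have "\<forall>p\<in>CxH. \<Phi> (g p) = \<Phi> p"
    unfolding G_eq
  proof (induction rule: generate.induct)
    case one
    show ?case
      by (simp add: BijGroup_simps)
  next
    case (incl h)
    then show ?case
      using gens by blast
  next
    case (inv h)
    then have h: "h \<in> Bij CxH"
      using gens_carrier by (auto simp: BijGroup_simps)
    show ?case
    proof
      fix p assume p: "p \<in> CxH"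
      then show "\<Phi> ((inv\<^bsub>BijGroup CxH\<^esub> h) p) = \<Phi> p"
        using gens[OF inv G_inv_apply(3)[OF h p]] G_inv_apply(2)[OF h p]
        by (simp add: inv_BijGroup[OF h])
    qed
  next
    case (eng g h)
    moreover have "g \<in> G" "h \<in> G"
      using eng by (simp_all add: G_eq)
    ultimately show ?case
      using G_Bij G_maps by (simp add: BijGroup_simps compose_def)
  qed
  then show ?thesis
    using \<open>p \<in> CxH\<close> by blast
qed

section \<open>Orbits and charts\<close>

definition \<pi> :: "C2 \<Rightarrow> C2 set" where
  "\<pi> = inoue_proj \<alpha> \<beta> a b"

lemma \<pi>_eq: "\<pi> p = (\<lambda>g. g p) ` G"
  by (simp add: \<pi>_def G_def inoue_proj_def)

lemma \<pi>_eq_iff: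
  assumes p: "p \<in> CxH" and q: "q \<in> CxH"
  shows "\<pi> p = \<pi> q \<longleftrightarrow> (\<exists>g\<in>G. g p = q)"
proof
  assume "\<pi> p = \<pi> q"
  moreover have "q \<in> \<pi> q"
    unfolding \<pi>_eq by (rule image_eqI[OF _ G_one]) (use q in simp)
  ultimately have "q \<in> \<pi> p"
    by simp
  then show "\<exists>g\<in>G. g p = q"
    unfolding \<pi>_eq by blast
next
  have sub: "\<pi> (g r) \<subseteq> \<pi> r" if "g \<in> G" "r \<in> CxH" for g r
  proof
    fix x assume "x \<in> \<pi> (g r)"
    then obtain h where "h \<in> G" "x = h (g r)"
      by (auto simp: \<pi>_eq)
    then show "x \<in> \<pi> r"
      unfolding \<pi>_eq using that by (intro image_eqI[OF _ G_comp[of h g]]) (auto simp: compose_def)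
  qed
  assume "\<exists>g\<in>G. g p = q"
  then obtain g where g: "g \<in> G" "g p = q"
    by blast
  have "restrict (inv_into CxH g) CxH q = p"
    using G_inv_apply(1)[OF G_Bij[OF g(1)] p] g(2) q by simp
  then show "\<pi> p = \<pi> q"
    using sub[OF g(1) p] sub[OF G_inv[OF g(1)] q] g(2) by auto
qed

definition atlas :: "C2 set chart set" where
  "atlas = inoue_S0 \<alpha> \<beta> a b"

definition chart :: "C2 set \<Rightarrow> C2 set chart" where
  "chart U = (\<pi> ` U, inv_into U \<pi>)"

definition evenly_covered :: "C2 set \<Rightarrow> bool" where
  "evenly_covered U \<longleftrightarrow> open U \<and> U \<subseteq> CxH \<and> inj_on \<pi> U"

lemma atlas_eq: "atlas = {chart U | U. evenly_covered U}"
  by (simp add: atlas_def chart_def evenly_covered_def inoue_S0_def \<pi>_def)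

lemma chart_target_chart: "evenly_covered U \<Longrightarrow> chart_target (chart U) = U"
  by (auto simp: evenly_covered_def chart_target_def chart_def image_image inv_into_f_f)

lemma chart_inv_chart:
  assumes "evenly_covered U" "p \<in> U"
  shows "chart_inv (chart U) p = \<pi> p"
proof -
  have "inj_on (inv_into U \<pi>) (\<pi> ` U)"
    by (rule inj_on_inv_into) simp
  moreover have "inv_into U \<pi> (\<pi> p) = p"
    using assms by (simp add: evenly_covered_def inv_into_f_f)
  ultimately show ?thesis
    using inv_into_f_f[of "inv_into U \<pi>" "\<pi> ` U" "\<pi> p"] \<open>p \<in> U\<close>
    by (simp add: chart_inv_def chart_def)
qed

lemma chart_overlap_chart:
  assumes U: "evenly_covered U" and V: "evenly_covered V"
  shows "p \<in> chart_overlap (chart U) (chart V) \<longleftrightarrow> p \<in> U \<and> (\<exists>g\<in>G. g p \<in> V)"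
proof -
  have inv: "inv_into U \<pi> (\<pi> q) = q" if "q \<in> U" for q
    using that U by (simp add: evenly_covered_def inv_into_f_f)
  have "\<pi> ` U \<inter> \<pi> ` V = \<pi> ` {q \<in> U. \<pi> q \<in> \<pi> ` V}"
    by blast
  then have "chart_overlap (chart U) (chart V) = inv_into U \<pi> ` \<pi> ` {q \<in> U. \<pi> q \<in> \<pi> ` V}"
    by (simp add: chart_overlap_def chart_def)
  also have "\<dots> = {q \<in> U. \<pi> q \<in> \<pi> ` V}"
    unfolding image_image using inv by simp
  finally have ov: "p \<in> chart_overlap (chart U) (chart V) \<longleftrightarrow> p \<in> U \<and> \<pi> p \<in> \<pi> ` V"
    by simp
  have "\<pi> p \<in> \<pi> ` V \<longleftrightarrow> (\<exists>g\<in>G. g p \<in> V)" if "p \<in> U"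
  proof -
    have "p \<in> CxH"
      using that U unfolding evenly_covered_def by blast
    moreover have "q \<in> CxH" if "q \<in> V" for q
      using that V unfolding evenly_covered_def by blast
    ultimately have "\<pi> p = \<pi> q \<longleftrightarrow> (\<exists>g\<in>G. g p = q)" if "q \<in> V" for q
      using \<pi>_eq_iff that by blast
    then show ?thesis
      unfolding image_iff by metis
  qed
  then show ?thesis
    using ov by blast
qed

text \<open>On the open set of those points of \<open>U\<close> that \<open>g\<close> carries into \<open>V\<close>, the
  transition map equals \<open>g\<close>, because the projection is injective on \<open>V\<close>.\<close>

lemma transition_chart:
  assumes U: "evenly_covered U" and V: "evenly_covered V" and g: "g \<in> G" "\<And>p. p \<in> CxH \<Longrightarrow> g p = dil n p + l"
    and p: "p \<in> U" "g p \<in> V"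
  shows "transition (chart U) (chart V) p = g p"
    and "frechet_derivative (transition (chart U) (chart V)) (at p) = dil n"
proof -
  let ?t = "transition (chart U) (chart V)"
  have t: "?t q = g q" if q: "q \<in> U" "g q \<in> V" for q
  proof -
    have "q \<in> CxH" "g q \<in> CxH"
      using q U V by (auto simp: evenly_covered_def)
    then have "\<pi> q = \<pi> (g q)"
      using \<pi>_eq_iff g(1) by blast
    then show ?thesis
      using q U V by (simp add: transition_def chart_inv_chart) (simp add: chart_def evenly_covered_def inv_into_f_f)
  qed
  then show "?t p = g p"
    using p by blast
  let ?W = "U \<inter> (\<lambda>q. dil n q + l) -` V"
  have der: "((\<lambda>q. dil n q + l) has_derivative dil n) (at q)" for q
    using linear_dil by (auto intro!: derivative_eq_intros bounded_linear_imp_has_derivative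
      simp: linear_conv_bounded_linear)
  have "open ?W"
    using U V der by (intro open_Int open_vimage continuous_at_imp_continuous_on ballI)
      (auto simp: evenly_covered_def intro: has_derivative_continuous)
  moreover have gU: "g q = dil n q + l" if "q \<in> U" for q
    using g(2) U that unfolding evenly_covered_def by blast
  moreover have "p \<in> ?W"
    using p gU by simp
  moreover have "dil n q + l = ?t q" if "q \<in> ?W" for q
    using that t gU by simp
  ultimately have "(?t has_derivative dil n) (at p)"
    using has_derivative_transform_within_open[OF der, of ?W p ?t] by blast
  then show "frechet_derivative ?t (at p) = dil n"
    by (rule frechet_derivative_at[symmetric])
qed

text \<open>The action is free and properly discontinuous: a nontrivial dilation factor changes the
  height \<open>Im w\<close> by at least the factor \<open>\<alpha>\<close>, and the lattice is discrete.\<close>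

lemma evenly_covered_neighbourhood:
  assumes p: "p \<in> CxH"
  obtains U where "evenly_covered U" "p \<in> U"
proof -
  have "inj lat"
    using lat_eq_0 linear_injective_0[OF linear_lat] by blast
  then obtain B where B: "B > 0" "\<And>u. B * norm u \<le> norm (lat u)"
    using linear_inj_bounded_below_pos[OF linear_lat] by blast
  define s where "s = Im (snd p)"
  define c where "c = sqrt \<alpha>"
  have s: "s > 0"
    using p by (simp add: s_def mem_CxH)
  have c: "c > 1" "c * c = \<alpha>"
    using alpha_gt_1 by (simp_all add: c_def)
  define U where "U = ball p (B / 2) \<inter> {q. s / c < Im (snd q)} \<inter> {q. Im (snd q) < s * c}"
  have "open U"
    unfolding U_def by (intro open_Int open_ball open_Collect_less continuous_intros)
  moreover have U_pos: "s / c < Im (snd q)" "Im (snd q) < s * c" "Im (snd q) > 0" if "q \<in> U" for q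
  proof -
    show *: "s / c < Im (snd q)" "Im (snd q) < s * c"
      using that by (auto simp: U_def)
    show "Im (snd q) > 0"
      using * s c by (meson divide_pos_pos less_trans zero_less_one)
  qed
  then have "U \<subseteq> CxH"
    by (auto simp: mem_CxH)
  moreover have "inj_on \<pi> U"
  proof (rule inj_onI)
    fix q q' assume q: "q \<in> U" "q' \<in> U" and eq: "\<pi> q = \<pi> q'"
    have qC: "q \<in> CxH" "q' \<in> CxH"
      using q \<open>U \<subseteq> CxH\<close> by blast+
    then obtain g where "g \<in> G" "g q = q'"
      using eq \<pi>_eq_iff by blast
    then obtain n l where nl: "l \<in> lattice" "q' = dil n q + l"
      using G_form qC by metis
    then have h: "Im (snd q') = \<alpha> powi n * Im (snd q)"
      using Im_snd_dil by (auto simp: lattice_def Im_snd_lat)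
    have ratio: "Im (snd x) < \<alpha> * Im (snd y)" if "x \<in> U" "y \<in> U" for x y
    proof -
      have "c * c * (s / c) = s * c"
        using c(1) by simp
      then have "Im (snd x) < c * c * (s / c)"
        using U_pos(2)[OF that(1)] by linarith
      also have "\<dots> \<le> \<alpha> * Im (snd y)"
        using U_pos(1)[OF that(2)] c s alpha_gt_1 by (intro mult_mono) auto
      finally show ?thesis .
    qed
    have "n = 0"
    proof (rule ccontr)
      assume "n \<noteq> 0"
      then consider "n \<ge> 1" | "n \<le> -1"
        by linarith
      then show False
      proof cases
        case 1
        then have "\<alpha> powi 1 \<le> \<alpha> powi n"
          using alpha_gt_1 by (intro power_int_increasing) auto
        then have "\<alpha> * Im (snd q) \<le> Im (snd q')"
          unfolding h using U_pos(3)[OF q(1)] by (intro mult_right_mono) auto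
        then show False
          using ratio[OF q(2,1)] by simp
      next
        case 2
        then have "\<alpha> powi n \<le> \<alpha> powi (-1)"
          using alpha_gt_1 by (intro power_int_increasing) auto
        then have "Im (snd q') \<le> \<alpha> powi (-1) * Im (snd q)"
          unfolding h using U_pos(3)[OF q(1)] by (intro mult_right_mono) auto
        then have "\<alpha> * Im (snd q') \<le> Im (snd q)"
          using alpha_gt_1 by (simp add: field_simps power_int_minus)
        then show False
          using ratio[OF q] by simp
      qed
    qed
    then have l: "l = q' - q"
      using nl by (simp add: dil_0)
    obtain k where k: "l = lat (real_vec k)"
      using nl by (auto simp: lattice_def)
    have "k = 0"
    proof (rule ccontr)
      assume "k \<noteq> 0"
      then obtain i where "k$i \<noteq> 0"
        by (auto simp: vec_eq_iff)
      then have "1 \<le> \<bar>real_vec k $ i\<bar>"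
        by (simp add: real_vec_def)
      also have "\<dots> \<le> norm (real_vec k)"
        by (rule component_le_norm_cart)
      finally have "B \<le> B * norm (real_vec k)"
        using B(1) by simp
      also have "\<dots> \<le> norm (q' - q)"
        using B(2) k l by metis
      also have "\<dots> = dist q' q"
        by (simp add: dist_norm)
      also have "\<dots> < B"
        using q dist_triangle3[of q' q p] by (simp add: U_def)
      finally show False
        by simp
    qed
    then show "q = q'"
      using k l by (simp add: real_vec_simps lat_simps)
  qed
  ultimately have "evenly_covered U"
    by (simp add: evenly_covered_def)
  moreover have "p \<in> U"
    using s c B(1) by (auto simp: U_def s_def[symmetric] field_simps)
  ultimately show thesis
    by (rule that)
qed

section \<open>Forms on the surface and invariant forms on the covering\<close>

text \<open>The coordinate expressions of a form patch to one expression on the covering; the charts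
  around a point agree there by the transition rule for the identity of the group, so the choice of
  chart is immaterial for forms.\<close>

definition lift :: "(C2 set chart \<Rightarrow> C2 \<Rightarrow> 'x) \<Rightarrow> C2 \<Rightarrow> 'x" where
  "lift X p = X (chart (SOME U. evenly_covered U \<and> p \<in> U)) p"

lemma lift_eq_some:
  assumes "p \<in> CxH"
  obtains V where "evenly_covered V" "p \<in> V" "lift X p = X (chart V) p"
  using someI_ex[of "\<lambda>U. evenly_covered U \<and> p \<in> U"] evenly_covered_neighbourhood[OF assms] unfolding lift_def by metis

lemma one_form_chart_change:
  assumes "one_form atlas \<eta>" "evenly_covered U" "evenly_covered V" "g \<in> G" "\<And>p. p \<in> CxH \<Longrightarrow> g p = dil n p + l"
    "p \<in> U" "g p \<in> V"
  shows "\<eta> (chart U) p v = \<eta> (chart V) (g p) (dil n v)"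
proof -
  have "p \<in> chart_overlap (chart U) (chart V)"
    using chart_overlap_chart assms by blast
  moreover have "chart U \<in> atlas" "chart V \<in> atlas"
    using assms by (auto simp: atlas_eq)
  ultimately show ?thesis
    using assms(1) transition_chart[OF assms(2-7)] unfolding one_form_def by metis
qed

lemma two_form_chart_change:
  assumes "two_form atlas \<omega>" "evenly_covered U" "evenly_covered V" "g \<in> G" "\<And>p. p \<in> CxH \<Longrightarrow> g p = dil n p + l"
    "p \<in> U" "g p \<in> V"
  shows "\<omega> (chart U) p u v = \<omega> (chart V) (g p) (dil n u) (dil n v)"
proof -
  have "p \<in> chart_overlap (chart U) (chart V)"
    using chart_overlap_chart assms by blast
  moreover have "chart U \<in> atlas" "chart V \<in> atlas"
    using assms by (auto simp: atlas_eq)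
  ultimately show ?thesis
    using assms(1) transition_chart[OF assms(2-7)] unfolding two_form_def by metis
qed

lemma G_one_form: "p \<in> CxH \<Longrightarrow> restrict (\<lambda>p. p) CxH p = dil 0 p + 0"
  by (simp add: dil_0)

lemma lift_one_form:
  assumes \<eta>: "one_form atlas \<eta>" and U: "evenly_covered U" "p \<in> U"
  shows "lift \<eta> p = \<eta> (chart U) p"
proof -
  have p: "p \<in> CxH"
    using U by (auto simp: evenly_covered_def)
  obtain V where V: "evenly_covered V" "p \<in> V" "lift \<eta> p = \<eta> (chart V) p"
    using lift_eq_some[OF p] by blast
  have "\<eta> (chart U) p v = \<eta> (chart V) p v" for v
    using one_form_chart_change[OF \<eta> U(1) V(1) G_one G_one_form U(2), of v] p V(2)
    by (simp add: dil_0)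
  then show ?thesis
    unfolding V(3) by (simp add: fun_eq_iff)
qed

lemma lift_two_form:
  assumes \<omega>: "two_form atlas \<omega>" and U: "evenly_covered U" "p \<in> U"
  shows "lift \<omega> p = \<omega> (chart U) p"
proof -
  have p: "p \<in> CxH"
    using U by (auto simp: evenly_covered_def)
  obtain V where V: "evenly_covered V" "p \<in> V" "lift \<omega> p = \<omega> (chart V) p"
    using lift_eq_some[OF p] by blast
  have "\<omega> (chart U) p u v = \<omega> (chart V) p u v" for u v
    using two_form_chart_change[OF \<omega> U(1) V(1) G_one G_one_form U(2), of u v] p V(2)
    by (simp add: dil_0)
  then show ?thesis
    unfolding V(3) by (simp add: fun_eq_iff)
qed

lemma lift_one_form_invariant:
  assumes \<eta>: "one_form atlas \<eta>" and g: "g \<in> G" "\<And>p. p \<in> CxH \<Longrightarrow> g p = dil n p + l"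
    and p: "p \<in> CxH"
  shows "lift \<eta> (g p) (dil n v) = lift \<eta> p v"
proof -
  obtain U V where "evenly_covered U" "p \<in> U" "evenly_covered V" "g p \<in> V"
    using evenly_covered_neighbourhood G_maps g(1) p by metis
  then show ?thesis
    using one_form_chart_change[OF \<eta> _ _ g] lift_one_form[OF \<eta>] by metis
qed

lemma lift_two_form_invariant:
  assumes \<omega>: "two_form atlas \<omega>" and g: "g \<in> G" "\<And>p. p \<in> CxH \<Longrightarrow> g p = dil n p + l"
    and p: "p \<in> CxH"
  shows "lift \<omega> (g p) (dil n u) (dil n v) = lift \<omega> p u v"
proof -
  obtain U V where "evenly_covered U" "p \<in> U" "evenly_covered V" "g p \<in> V"
    using evenly_covered_neighbourhood G_maps g(1) p by metis
  then show ?thesis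
    using two_form_chart_change[OF \<omega> _ _ g] lift_two_form[OF \<omega>] by metis
qed

lemma dil_in_G: "restrict (dil 1) CxH \<in> G" and translate_in_G: "restrict (\<lambda>p. p + e i) CxH \<in> G"
  by (auto simp: G_eq gens_def intro: generate.incl)

lemma lift_one_form_dil:
  assumes "one_form atlas \<eta>" "p \<in> CxH"
  shows "lift \<eta> (dil 1 p) (dil 1 v) = lift \<eta> p v"
  using lift_one_form_invariant[OF assms(1) dil_in_G _ assms(2), where n = 1 and l = 0] assms(2) by simp

lemma lift_one_form_translate:
  assumes "one_form atlas \<eta>" "p \<in> CxH"
  shows "lift \<eta> (p + e i) v = lift \<eta> p v"
  using lift_one_form_invariant[OF assms(1) translate_in_G[of i] _ assms(2), where n = 0 and l = "e i" and v = v] assms(2)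
  by (simp add: dil_0)

lemma lift_two_form_dil:
  assumes "two_form atlas \<omega>" "p \<in> CxH"
  shows "lift \<omega> (dil 1 p) (dil 1 u) (dil 1 v) = lift \<omega> p u v"
  using lift_two_form_invariant[OF assms(1) dil_in_G _ assms(2), where n = 1 and l = 0] assms(2) by simp

lemma lift_two_form_translate:
  assumes "two_form atlas \<omega>" "p \<in> CxH"
  shows "lift \<omega> (p + e i) u v = lift \<omega> p u v"
  using lift_two_form_invariant[OF assms(1) translate_in_G[of i] _ assms(2), where n = 0 and l = "e i" and u = u and v = v] assms(2)
  by (simp add: dil_0)

lemma lift_closed_one_form:
  assumes \<eta>: "\<eta> \<in> closed_one_forms atlas"
  shows "p \<in> CxH \<Longrightarrow> linear (lift \<eta> p)"
    and "smooth_on CxH (\<lambda>p. lift \<eta> p v)"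
    and "p \<in> CxH \<Longrightarrow> ext_d1 (lift \<eta>) p u v = 0"
proof -
  have of: "one_form atlas \<eta>"
    using \<eta> by (simp add: closed_one_forms_def)
  have loc: "\<exists>U. open U \<and> p \<in> U \<and> smooth_on U (\<lambda>p. \<eta> (chart U) p v) \<and> linear (\<eta> (chart U) p) \<and>
      ext_d1 (\<eta> (chart U)) p u v = 0 \<and> (\<forall>x\<in>U. lift \<eta> x = \<eta> (chart U) x)"
    if p: "p \<in> CxH" for p u v
  proof -
    obtain U where U: "evenly_covered U" "p \<in> U"
      using evenly_covered_neighbourhood[OF p] by blast
    have "chart U \<in> atlas"
      using U by (auto simp: atlas_eq)
    then have "\<forall>p\<in>chart_target (chart U). linear (\<eta> (chart U) p)"
      "smooth_on (chart_target (chart U)) (\<lambda>p. \<eta> (chart U) p v)"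
      "\<forall>p\<in>chart_target (chart U). ext_d1 (\<eta> (chart U)) p u v = 0"
      using \<eta> unfolding closed_one_forms_def one_form_def by blast+
    moreover have "open U" "\<forall>x\<in>U. lift \<eta> x = \<eta> (chart U) x"
      using U lift_one_form[OF of U(1)] unfolding evenly_covered_def by blast+
    ultimately show ?thesis
      using U(2) unfolding chart_target_chart[OF U(1)] by blast
  qed
  show "linear (lift \<eta> p)" if "p \<in> CxH"
    using loc[OF that] by metis
  show "smooth_on CxH (\<lambda>p. lift \<eta> p v)"
  proof (rule smooth_on_local)
    fix p assume "p \<in> CxH"
    from loc[OF this, of v v] obtain U where
      "open U" "p \<in> U" "smooth_on U (\<lambda>p. \<eta> (chart U) p v)" "\<forall>x\<in>U. lift \<eta> x = \<eta> (chart U) x"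
      by (elim exE conjE)
    then show "\<exists>U g. open U \<and> p \<in> U \<and> smooth_on U g \<and> (\<forall>x\<in>U. lift \<eta> x v = g x)"
      by (intro exI[of _ U] exI[of _ "\<lambda>p. \<eta> (chart U) p v"]) simp
  qed
  show "ext_d1 (lift \<eta>) p u v = 0" if pC: "p \<in> CxH"
  proof -
    obtain U where U: "open U" "p \<in> U" "ext_d1 (\<eta> (chart U)) p u v = 0"
      "\<forall>x\<in>U. lift \<eta> x = \<eta> (chart U) x"
      using loc[OF pC, of v u] by (elim exE conjE)
    have "ext_d0 (\<lambda>x. lift \<eta> x w) p w' = ext_d0 (\<lambda>x. \<eta> (chart U) x w) p w'" for w w'
      by (rule ext_d0_cong[OF U(1,2)]) (use U(4) in simp)
    then show ?thesis
      using U(3) by (simp add: ext_d1_def)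
  qed
qed

lemma lift_taming_form:
  assumes \<omega>: "two_form atlas \<omega>" "tames_J atlas \<omega>" and \<eta>: "one_form atlas \<eta>"
    and tw: "\<And>c p u v w. c \<in> atlas \<Longrightarrow> p \<in> chart_target c \<Longrightarrow> twisted_d2 (\<eta> c) (\<omega> c) p u v w = 0"
  shows "p \<in> CxH \<Longrightarrow> bilinear (lift \<omega> p)"
    and "p \<in> CxH \<Longrightarrow> lift \<omega> p u u = 0"
    and "p \<in> CxH \<Longrightarrow> u \<noteq> 0 \<Longrightarrow> lift \<omega> p u (J_std u) > 0"
    and "smooth_on CxH (\<lambda>p. lift \<omega> p u v)"
    and "p \<in> CxH \<Longrightarrow> twisted_d2 (lift \<eta>) (lift \<omega>) p u v w = 0"
proof -
  have loc: "\<exists>U. open U \<and> p \<in> U \<and> smooth_on U (\<lambda>p. \<omega> (chart U) p u v) \<and>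
      bilinear (\<omega> (chart U) p) \<and> \<omega> (chart U) p u u = 0 \<and>
      (u \<noteq> 0 \<longrightarrow> \<omega> (chart U) p u (J_std u) > 0) \<and>
      twisted_d2 (\<eta> (chart U)) (\<omega> (chart U)) p u v w = 0 \<and>
      (\<forall>x\<in>U. lift \<omega> x = \<omega> (chart U) x) \<and> lift \<eta> p = \<eta> (chart U) p"
    if p: "p \<in> CxH" for p u v w
  proof -
    obtain U where U: "evenly_covered U" "p \<in> U"
      using evenly_covered_neighbourhood[OF p] by blast
    have "chart U \<in> atlas"
      using U by (auto simp: atlas_eq)
    then have "\<forall>p\<in>chart_target (chart U). bilinear (\<omega> (chart U) p) \<and> \<omega> (chart U) p u u = 0"
      "smooth_on (chart_target (chart U)) (\<lambda>p. \<omega> (chart U) p u v)"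
      "\<forall>p\<in>chart_target (chart U). u \<noteq> 0 \<longrightarrow> \<omega> (chart U) p u (J_std u) > 0"
      "\<forall>p\<in>chart_target (chart U). twisted_d2 (\<eta> (chart U)) (\<omega> (chart U)) p u v w = 0"
      using \<omega> tw unfolding two_form_def tames_J_def by blast+
    note facts = this[unfolded chart_target_chart[OF U(1)]]
    have "open U"
      using U(1) by (simp add: evenly_covered_def)
    then show ?thesis
      using facts(2) bspec[OF facts(1) U(2)] bspec[OF facts(3) U(2)] bspec[OF facts(4) U(2)] U(2)
        lift_two_form[OF \<omega>(1) U(1)] lift_one_form[OF \<eta> U]
      by (intro exI[of _ U] conjI ballI) simp_all
  qed
  show "bilinear (lift \<omega> p)" if "p \<in> CxH"
    using loc[OF that] by metis
  show "lift \<omega> p u u = 0" if "p \<in> CxH"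
    using loc[OF that, of u] by metis
  show "lift \<omega> p u (J_std u) > 0" if "p \<in> CxH" "u \<noteq> 0"
    using loc[OF that(1), of u] that(2) by metis
  show "smooth_on CxH (\<lambda>p. lift \<omega> p u v)"
  proof (rule smooth_on_local)
    fix p assume "p \<in> CxH"
    from loc[OF this, of u v u] obtain U where
      "open U" "p \<in> U" "smooth_on U (\<lambda>p. \<omega> (chart U) p u v)" "\<forall>x\<in>U. lift \<omega> x = \<omega> (chart U) x"
      by (elim exE conjE)
    then show "\<exists>U g. open U \<and> p \<in> U \<and> smooth_on U g \<and> (\<forall>x\<in>U. lift \<omega> x u v = g x)"
      by (intro exI[of _ U] exI[of _ "\<lambda>p. \<omega> (chart U) p u v"]) simp
  qed
  show "twisted_d2 (lift \<eta>) (lift \<omega>) p u v w = 0" if pC: "p \<in> CxH"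
  proof -
    obtain U where U: "open U" "p \<in> U" "twisted_d2 (\<eta> (chart U)) (\<omega> (chart U)) p u v w = 0"
      "\<forall>x\<in>U. lift \<omega> x = \<omega> (chart U) x" "lift \<eta> p = \<eta> (chart U) p"
      using loc[OF pC, of u v w] by (elim exE conjE)
    have "ext_d0 (\<lambda>x. lift \<omega> x v' w) p w' = ext_d0 (\<lambda>x. \<omega> (chart U) x v' w) p w'" for v' w w'
      by (rule ext_d0_cong[OF U(1,2)]) (use U(4) in simp)
    then show ?thesis
      using U by (simp add: twisted_d2_def ext_d2_def wedge12_def)
  qed
qed

lemma cohomologousI:
  assumes \<eta>: "\<eta> \<in> closed_one_forms atlas" "\<eta>' \<in> closed_one_forms atlas"
    and sm: "smooth_on CxH \<Phi>"
    and inv: "\<And>g p. g \<in> G \<Longrightarrow> p \<in> CxH \<Longrightarrow> \<Phi> (g p) = \<Phi> p"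
    and diff: "\<And>p v. p \<in> CxH \<Longrightarrow> lift \<eta>' p v - lift \<eta> p v = ext_d0 \<Phi> p v"
  shows "(\<eta>, \<eta>') \<in> cohomologous atlas"
proof -
  define f where "f x = \<Phi> (SOME p. p \<in> CxH \<and> \<pi> p = x)" for x
  have f: "f (\<pi> p) = \<Phi> p" if p: "p \<in> CxH" for p
  proof -
    define q where "q = (SOME q. q \<in> CxH \<and> \<pi> q = \<pi> p)"
    have "q \<in> CxH \<and> \<pi> q = \<pi> p"
      unfolding q_def by (rule someI[of _ p]) (use p in simp)
    then show ?thesis
      unfolding f_def q_def[symmetric] using \<pi>_eq_iff p inv by metis
  qed
  have fc: "(f \<circ> chart_inv (chart U)) p = \<Phi> p" if "evenly_covered U" "p \<in> U" for U p
  proof -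
    have "p \<in> CxH"
      using that unfolding evenly_covered_def by blast
    then show ?thesis
      using chart_inv_chart[OF that] f by simp
  qed
  have of: "one_form atlas \<eta>" "one_form atlas \<eta>'"
    using \<eta> by (simp_all add: closed_one_forms_def)
  have "smooth_fun atlas f"
    unfolding smooth_fun_def
  proof
    fix c assume "c \<in> atlas"
    then obtain U where U: "c = chart U" "evenly_covered U"
      by (auto simp: atlas_eq)
    have "open U" "U \<subseteq> CxH"
      using U(2) by (simp_all add: evenly_covered_def)
    from smooth_on_cong[OF this(1) smooth_on_subset[OF sm this(2)] fc[OF U(2)]]
    show "smooth_on (chart_target c) (f \<circ> chart_inv c)"
      unfolding U(1) chart_target_chart[OF U(2)] .
  qed
  moreover have "\<eta>' c p v - \<eta> c p v = ext_d0 (f \<circ> chart_inv c) p v"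
    if "c \<in> atlas" "p \<in> chart_target c" for c p v
  proof -
    obtain U where U: "c = chart U" "evenly_covered U"
      using \<open>c \<in> atlas\<close> unfolding atlas_eq by blast
    have p: "p \<in> U"
      using that(2) unfolding U(1) chart_target_chart[OF U(2)] .
    have "open U" "p \<in> CxH"
      using U(2) p unfolding evenly_covered_def by blast+
    have "ext_d0 (f \<circ> chart_inv c) p v = ext_d0 \<Phi> p v"
      unfolding U(1) by (rule ext_d0_cong[OF \<open>open U\<close> p fc[OF U(2)]])
    then show ?thesis
      using diff[OF \<open>p \<in> CxH\<close>] lift_one_form[OF of(1) U(2) p] lift_one_form[OF of(2) U(2) p] U(1) by simp
  qed
  ultimately show ?thesis
    using \<eta> unfolding cohomologous_def by blast
qed

end

section \<open>Averages over grids in the torus fibres\<close>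

definition grid :: "nat \<Rightarrow> (int^3) set" where
  "grid N = {k. \<forall>i. 0 \<le> k$i \<and> k$i < int N}"

lemma finite_grid: "finite (grid N)"
proof -
  have "(\<lambda>k i. k$i) ` grid N \<subseteq> (\<Pi>\<^sub>E i\<in>UNIV. {0..<int N})"
    by (auto simp: grid_def)
  then have "finite ((\<lambda>k i. k$i) ` grid N)"
    by (rule finite_subset) (intro finite_PiE; simp)
  then show ?thesis
    by (rule finite_imageD) (auto simp: inj_on_def vec_eq_iff fun_eq_iff)
qed

lemma card_grid_pos: "N > 0 \<Longrightarrow> card (grid N) > 0"
  using finite_grid[of N] by (subst card_gt_0_iff) (auto simp: grid_def intro!: exI[of _ 0])

text \<open>A self-map of the finite group \<open>(\<int>/N)^3\<close> that is injective is a permutation.\<close>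

lemma sum_grid_permute:
  fixes H :: "int^3 \<Rightarrow> real"
  assumes "N > 0"
    and per: "\<And>k k'. (\<And>i. int N dvd k$i - k'$i) \<Longrightarrow> H k = H k'"
    and inj: "\<And>k k' i. (\<And>i. int N dvd \<phi> k$i - \<phi> k'$i) \<Longrightarrow> int N dvd k$i - k'$i"
  shows "(\<Sum>k\<in>grid N. H (\<phi> k)) = (\<Sum>k\<in>grid N. H k)"
proof -
  define \<sigma> where "\<sigma> k = (\<chi> i. \<phi> k$i mod int N)" for k
  have "\<sigma> ` grid N \<subseteq> grid N"
    using \<open>N > 0\<close> by (auto simp: grid_def \<sigma>_def)
  moreover have "inj_on \<sigma> (grid N)"
  proof (rule inj_onI)
    fix k k' assume k: "k \<in> grid N" "k' \<in> grid N" and "\<sigma> k = \<sigma> k'"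
    then have "int N dvd \<phi> k$i - \<phi> k'$i" for i
      by (simp add: \<sigma>_def vec_eq_iff mod_eq_dvd_iff)
    then have "k$i mod int N = k'$i mod int N" for i
      using inj by (simp add: mod_eq_dvd_iff)
    then have "k$i = k'$i" for i
      using k by (simp add: grid_def)
    then show "k = k'"
      by (simp add: vec_eq_iff)
  qed
  ultimately have "bij_betw \<sigma> (grid N) (grid N)"
    using endo_inj_surj[OF finite_grid] by (simp add: bij_betw_def)
  then have "(\<Sum>k\<in>grid N. H (\<sigma> k)) = (\<Sum>k\<in>grid N. H k)"
    by (rule sum.reindex_bij_betw)
  moreover have "H (\<phi> k) = H (\<sigma> k)" for k
    by (rule per) (simp add: \<sigma>_def minus_mod_eq_mult_div)
  ultimately show ?thesis
    by simp
qed

context inoue_data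
begin

text \<open>The constants \<open>c$i\<close> add up along a lattice vector; \<open>c = 0\<close> is the case of a lattice-periodic
  function.\<close>

lemma lattice_step:
  fixes h :: "C2 \<Rightarrow> real" and k :: "int^3"
  assumes h: "\<And>i p. p \<in> CxH \<Longrightarrow> h (p + e i) = h p + c$i" and p: "p \<in> CxH"
  shows "h (p + lat (real_vec k)) = h p + (\<Sum>i\<in>UNIV. of_int (k$i) * c$i)"
proof -
  have mem: "q + x *\<^sub>R e i \<in> CxH" if "q \<in> CxH" for q x i
    using translate_mem_CxH[OF that, of "axis i x"] by (simp add: lat_axis)
  have line: "h (q + of_int m *\<^sub>R e i) = h q + of_int m * c$i" if q: "q \<in> CxH" for q i m
  proof (induction m rule: int_induct[where k = 0])
    case (step1 m)
    then show ?case
      using h[OF mem[OF q, of "of_int m" i], of i] by (simp add: algebra_simps)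
  next
    case (step2 m)
    then show ?case
      using h[OF mem[OF q, of "of_int (m - 1)" i], of i] by (simp add: algebra_simps)
  qed simp
  have eq: "p + lat (real_vec k) =
      ((p + of_int (k$1) *\<^sub>R e 1) + of_int (k$2) *\<^sub>R e 2) + of_int (k$3) *\<^sub>R e 3"
    by (simp add: lat_def sum_3 real_vec_def)
  show ?thesis
    unfolding eq using p by (simp add: line mem sum_3)
qed

lemma continuous_on_lat: "continuous_on UNIV lat"
  using linear_lat by (intro linear_continuous_on) (simp add: linear_conv_bounded_linear)

text \<open>The points of the fibre over height \<open>s\<close> whose lattice coordinates lie in \<open>(1/N) \<int>^3\<close>.\<close>

definition grid_point :: "nat \<Rightarrow> real \<Rightarrow> int^3 \<Rightarrow> C2" where
  "grid_point N s k = (0, \<i> * of_real s) + lat ((1 / real N) *\<^sub>R real_vec k)"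

lemma grid_point_mem_CxH: "s > 0 \<Longrightarrow> grid_point N s k \<in> CxH"
  unfolding grid_point_def by (rule translate_mem_CxH) (simp add: mem_CxH)

lemma grid_point_periodic:
  assumes h: "\<And>i p. p \<in> CxH \<Longrightarrow> h (p + e i) = (h p :: real)" and "N > 0" "s > 0"
    and k: "\<And>i. int N dvd k$i - k'$i"
  shows "h (grid_point N s k) = h (grid_point N s k')"
proof -
  obtain m :: "int^3" where "\<forall>i. k$i - k'$i = int N * m$i"
  proof -
    have "\<forall>i. \<exists>j. k$i - k'$i = int N * j"
      using k by (auto simp: dvd_def)
    then obtain j where "\<forall>i. k$i - k'$i = int N * j i"
      by metis
    then show thesis
      using that[of "\<chi> i. j i"] by simp
  qed
  then have "of_int (k$i) = of_int (k'$i) + real N * of_int (m$i)" for i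
    by (metis add.commute diff_add_cancel of_int_add of_int_mult of_int_of_nat_eq)
  then have "(1 / real N) *\<^sub>R real_vec k = (1 / real N) *\<^sub>R real_vec k' + real_vec m"
    using \<open>N > 0\<close> by (simp add: vec_eq_iff real_vec_def field_simps)
  then have "grid_point N s k = grid_point N s k' + lat (real_vec m)"
    by (simp add: grid_point_def lat_simps)
  then show ?thesis
    using lattice_step[of h 0, OF _ grid_point_mem_CxH[OF \<open>s > 0\<close>]] h by simp
qed

text \<open>The dilation maps the fibre over height \<open>s\<close> to the one over \<open>\<alpha> s\<close>, and acts on the grid points
  as the matrix \<open>A\<close>, which is invertible modulo every \<open>N\<close>.\<close>

lemma sum_grid_dil:
  assumes h: "\<And>i p. p \<in> CxH \<Longrightarrow> h (p + e i) = (h p :: real)" and "N > 0" "s > 0"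
  shows "(\<Sum>k\<in>grid N. h (dil 1 (grid_point N s k))) = (\<Sum>k\<in>grid N. h (grid_point N (\<alpha> * s) k))"
proof -
  obtain B where B: "A ** B = mat 1"
    using int_matrix_inverse_3[of A] data unfolding inoue_S0_data_def by metis
  have "dil 1 (grid_point N s k) = grid_point N (\<alpha> * s) (k v* A)" for k
  proof -
    have "dil 1 (0, \<i> * of_real s) = (0, \<i> * of_real (\<alpha> * s))"
      by (simp add: dil_1)
    then show ?thesis
      unfolding grid_point_def dil_simps lat_simps by (simp add: dil_simps dil_lat_real_vec)
  qed
  moreover have "(\<Sum>k\<in>grid N. h (grid_point N (\<alpha> * s) (k v* A))) = (\<Sum>k\<in>grid N. h (grid_point N (\<alpha> * s) k))"
  proof (rule sum_grid_permute[where \<phi> = "\<lambda>k. k v* A" and H = "\<lambda>k. h (grid_point N (\<alpha> * s) k)", OF \<open>N > 0\<close>])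
    show "h (grid_point N (\<alpha> * s) k) = h (grid_point N (\<alpha> * s) k')" if "\<And>i. int N dvd k$i - k'$i" for k k'
      by (rule grid_point_periodic[OF h \<open>N > 0\<close> _ that]) (use alpha_gt_1 \<open>s > 0\<close> in auto)
    show "int N dvd k$i - k'$i" if d: "\<And>i. int N dvd (k v* A)$i - (k' v* A)$i" for k k' i
    proof -
      have "k - k' = (k v* A - k' v* A) v* B"
        by (simp add: vector_matrix_mult_diff_distrib vector_matrix_mul_assoc B)
      then have "(k - k')$i = ((k v* A - k' v* A) v* B)$i"
        by (rule arg_cong)
      then have "k$i - k'$i = (\<Sum>j\<in>UNIV. ((k v* A)$j - (k' v* A)$j) * B$j$i)"
        unfolding vector_matrix_mult_def[of "k v* A - k' v* A"] by simp
      then show ?thesis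
        using d by (simp add: dvd_sum)
    qed
  qed
  ultimately show ?thesis
    by simp
qed

text \<open>Along \<open>e i\<close> a difference quotient of step \<open>1/N\<close> sums to zero over the grid, and by uniform
  continuity it approximates the derivative.\<close>

lemma sum_grid_derivative_e:
  fixes g :: "C2 \<Rightarrow> real" and \<epsilon> :: real
  assumes der: "\<And>p. p \<in> CxH \<Longrightarrow> (g has_derivative g' p) (at p)"
    and cont: "continuous_on CxH (\<lambda>p. g' p (e i))"
    and per: "\<And>i p. p \<in> CxH \<Longrightarrow> g (p + e i) = g p" and "\<epsilon> > 0"
  shows "\<forall>\<^sub>F N in sequentially. \<forall>s\<in>{1..\<alpha>}.
    \<bar>\<Sum>k\<in>grid N. g' (grid_point N s k) (e i)\<bar> \<le> \<epsilon> * card (grid N)"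
proof -
  define P where "P x = (0, \<i> * of_real (snd x)) + lat (fst x)" for x :: "(real^3) \<times> real"
  define box :: "(real^3) set" where "box = cbox 0 (\<chi> i. 2)"
  define K where "K = P ` (box \<times> {1..\<alpha>})"
  have "continuous_on (box \<times> {1..\<alpha>}) P"
    unfolding P_def by (intro continuous_intros continuous_on_compose2[OF continuous_on_lat]) simp_all
  then have "compact K"
    unfolding K_def box_def by (intro compact_continuous_image compact_Times compact_cbox compact_Icc)
  have "K \<subseteq> CxH"
    unfolding K_def P_def by (intro image_subsetI translate_mem_CxH) (auto simp: mem_CxH)
  have "uniformly_continuous_on K (\<lambda>p. g' p (e i))"
    using compact_uniformly_continuous[OF continuous_on_subset[OF cont \<open>K \<subseteq> CxH\<close>] \<open>compact K\<close>] .
  then obtain \<delta> where \<delta>: "\<delta> > 0"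
    "\<And>p q. p \<in> K \<Longrightarrow> q \<in> K \<Longrightarrow> dist q p < \<delta> \<Longrightarrow> dist (g' q (e i)) (g' p (e i)) < \<epsilon>"
    unfolding uniformly_continuous_on_def using \<open>\<epsilon> > 0\<close> by metis
  have "(\<lambda>N. norm (e i) / real N) \<longlonglongrightarrow> 0"
    by (rule lim_const_over_n)
  then have ev: "\<forall>\<^sub>F N in sequentially. norm (e i) / real N < \<delta>"
    using order_tendstoD(2) \<delta>(1) by blast
  show ?thesis
    using ev eventually_gt_at_top[of 0]
  proof eventually_elim
    case (elim N)
    then have N: "real N > 0" "real N \<ge> 1"
      by simp_all
    show ?case
    proof
      fix s assume s: "s \<in> {1..\<alpha>}"
      have Q_K: "grid_point N s k + (\<tau> / N) *\<^sub>R e i \<in> K" if k: "k \<in> grid N" and \<tau>: "0 \<le> \<tau>" "\<tau> \<le> 1" for k \<tau>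
      proof -
        define u where "u = (1 / real N) *\<^sub>R real_vec k + axis i (\<tau> / N)"
        have "grid_point N s k + (\<tau> / N) *\<^sub>R e i = P (u, s)"
          by (simp add: u_def P_def grid_point_def lat_simps lat_axis)
        moreover have "u \<in> box"
          unfolding box_def mem_box_cart
        proof
          fix j
          have "real_of_int (k$j) \<ge> 0" "real_of_int (k$j) \<le> real N"
            using k by (auto simp: grid_def less_imp_le) (metis less_imp_le of_int_le_iff of_int_of_nat_eq)
          then have "0 \<le> real_of_int (k$j) / N" "real_of_int (k$j) / N \<le> 1"
            using N by simp_all
          moreover have "0 \<le> \<tau> / N" "\<tau> / N \<le> 1"
            using N \<tau> by (simp_all add: field_simps)
          ultimately show "(0::real^3) $ j \<le> u $ j \<and> u $ j \<le> (\<chi> i. 2) $ j"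
            by (auto simp: u_def real_vec_def axis_def)
        qed
        ultimately show ?thesis
          using s by (auto simp: K_def)
      qed
      define r where "r k = g' (grid_point N s k) (e i) - real N * (g (grid_point N s (k + axis i 1)) - g (grid_point N s k))" for k
      have r: "\<bar>r k\<bar> \<le> \<epsilon>" if k: "k \<in> grid N" for k
      proof -
        define \<gamma> where "\<gamma> \<tau> = grid_point N s k + (\<tau> / N) *\<^sub>R e i" for \<tau>
        have \<gamma>1: "\<gamma> 1 = grid_point N s (k + axis i 1)"
          by (simp add: \<gamma>_def grid_point_def real_vec_simps real_vec_axis lat_simps lat_axis scaleR_add_right)
        have "((\<lambda>\<tau>. g (\<gamma> \<tau>)) has_real_derivative g' (\<gamma> \<tau>) (e i) / N) (at \<tau>)"
          if \<tau>: "0 \<le> \<tau>" "\<tau> \<le> 1" for \<tau>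
        proof -
          have C: "\<gamma> \<tau> \<in> CxH"
            using Q_K[OF k \<tau>] \<open>K \<subseteq> CxH\<close> by (auto simp: \<gamma>_def)
          have "(\<gamma> has_derivative (\<lambda>h. (h / N) *\<^sub>R e i)) (at \<tau>)"
            unfolding \<gamma>_def using N by (auto intro!: derivative_eq_intros)
          from diff_chain_at[OF this der[OF C]]
          have "((\<lambda>\<tau>. g (\<gamma> \<tau>)) has_derivative (\<lambda>h. g' (\<gamma> \<tau>) ((h / N) *\<^sub>R e i))) (at \<tau>)"
            by (simp add: o_def)
          moreover have "(\<lambda>h. g' (\<gamma> \<tau>) ((h / N) *\<^sub>R e i)) = (*) (g' (\<gamma> \<tau>) (e i) / N)"
            using linear_scale[OF has_derivative_linear[OF der[OF C]]] by (simp add: fun_eq_iff)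
          ultimately show ?thesis
            unfolding has_field_derivative_def by (simp only:)
        qed
        then obtain \<xi> where \<xi>: "0 < \<xi>" "\<xi> < 1" "g (\<gamma> 1) - g (\<gamma> 0) = (1 - 0) * (g' (\<gamma> \<xi>) (e i) / N)"
          using MVT2[of 0 1 "\<lambda>\<tau>. g (\<gamma> \<tau>)" "\<lambda>\<tau>. g' (\<gamma> \<tau>) (e i) / N"] by auto
        have "\<gamma> 0 = grid_point N s k"
          by (simp add: \<gamma>_def)
        then have "g' (\<gamma> \<xi>) (e i) = real N * (g (grid_point N s (k + axis i 1)) - g (grid_point N s k))"
          using \<xi>(3) \<gamma>1 N by simp
        then have "\<bar>r k\<bar> = dist (g' (\<gamma> \<xi>) (e i)) (g' (\<gamma> 0) (e i))"
          using \<open>\<gamma> 0 = grid_point N s k\<close> by (simp add: r_def dist_real_def abs_minus_commute)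
        moreover have "dist (\<gamma> \<xi>) (\<gamma> 0) < \<delta>"
        proof -
          have "dist (\<gamma> \<xi>) (\<gamma> 0) = \<xi> * (norm (e i) / N)"
            using \<xi> by (simp add: \<gamma>_def dist_norm)
          also have "\<dots> \<le> 1 * (norm (e i) / N)"
            using \<xi> N by (intro mult_right_mono) auto
          finally show ?thesis
            using elim(1) by simp
        qed
        moreover have "\<gamma> \<xi> \<in> K" "\<gamma> 0 \<in> K"
          using Q_K[OF k, of \<xi>] Q_K[OF k, of 0] \<xi> by (simp_all add: \<gamma>_def)
        ultimately show ?thesis
          using \<delta>(2)[of "\<gamma> 0" "\<gamma> \<xi>"] by simp
      qed
      have "(\<Sum>k\<in>grid N. g (grid_point N s (k + axis i 1))) = (\<Sum>k\<in>grid N. g (grid_point N s k))"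
      proof (rule sum_grid_permute[where \<phi> = "\<lambda>k. k + axis i 1" and H = "\<lambda>k. g (grid_point N s k)"])
        show "g (grid_point N s k) = g (grid_point N s k')" if "\<And>i. int N dvd k$i - k'$i" for k k'
          by (rule grid_point_periodic[OF per _ _ that]) (use s elim in auto)
      qed (use elim in auto)
      then have "(\<Sum>k\<in>grid N. g' (grid_point N s k) (e i)) = (\<Sum>k\<in>grid N. r k)"
        by (simp add: r_def sum_subtractf sum_distrib_left[symmetric])
      moreover have "\<bar>\<Sum>k\<in>grid N. r k\<bar> \<le> (\<Sum>k\<in>grid N. \<epsilon>)"
        using r by (intro order_trans[OF sum_abs] sum_mono)
      ultimately show "\<bar>\<Sum>k\<in>grid N. g' (grid_point N s k) (e i)\<bar> \<le> \<epsilon> * card (grid N)"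
        by (simp add: mult.commute)
    qed
  qed
qed

lemma sum_grid_derivative:
  fixes g :: "C2 \<Rightarrow> real" and \<epsilon> :: real
  assumes der: "\<And>p. p \<in> CxH \<Longrightarrow> (g has_derivative g' p) (at p)"
    and cont: "\<And>v. continuous_on CxH (\<lambda>p. g' p v)"
    and per: "\<And>i p. p \<in> CxH \<Longrightarrow> g (p + e i) = g p" and "\<epsilon> > 0"
  shows "\<forall>\<^sub>F N in sequentially. \<forall>s\<in>{1..\<alpha>}.
    \<bar>\<Sum>k\<in>grid N. g' (grid_point N s k) (\<zeta>, 0)\<bar> \<le> \<epsilon> * card (grid N)"
proof -
  obtain u where u: "lat u = (\<zeta>, 0)"
    using lat_surj by blast
  define C where "C = 1 + (\<Sum>i\<in>UNIV. \<bar>u$i\<bar>)"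
  have C: "C > 0"
    unfolding C_def by (intro add_pos_nonneg sum_nonneg) auto
  have "\<forall>\<^sub>F N in sequentially. \<forall>i. \<forall>s\<in>{1..\<alpha>}.
      \<bar>\<Sum>k\<in>grid N. g' (grid_point N s k) (e i)\<bar> \<le> (\<epsilon> / C) * card (grid N)"
    using C \<open>\<epsilon> > 0\<close> by (intro eventually_all_finite sum_grid_derivative_e[OF der cont per]) simp_all
  then show ?thesis
  proof eventually_elim
    case (elim N)
    show ?case
    proof
      fix s assume s: "s \<in> {1..\<alpha>}"
      have "g' (grid_point N s k) (\<zeta>, 0) = (\<Sum>i\<in>UNIV. u$i * g' (grid_point N s k) (e i))" for k
      proof -
        have "linear (g' (grid_point N s k))"
          using has_derivative_linear[OF der[OF grid_point_mem_CxH]] s by simp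
        then show ?thesis
          unfolding u[symmetric] lat_def by (simp add: linear_sum linear_scale)
      qed
      then have "(\<Sum>k\<in>grid N. g' (grid_point N s k) (\<zeta>, 0)) =
          (\<Sum>i\<in>UNIV. u$i * (\<Sum>k\<in>grid N. g' (grid_point N s k) (e i)))"
        by (simp add: sum_distrib_left) (rule sum.swap)
      also have "\<bar>\<dots>\<bar> \<le> (\<Sum>i\<in>UNIV. \<bar>u$i\<bar> * ((\<epsilon> / C) * card (grid N)))"
      proof (intro order_trans[OF sum_abs] sum_mono)
        fix i
        show "\<bar>u$i * (\<Sum>k\<in>grid N. g' (grid_point N s k) (e i))\<bar> \<le> \<bar>u$i\<bar> * ((\<epsilon> / C) * card (grid N))"
          unfolding abs_mult by (rule mult_left_mono) (use elim s in \<open>blast, simp\<close>)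
      qed
      also have "\<dots> = (C - 1) * ((\<epsilon> / C) * card (grid N))"
        unfolding sum_distrib_right[symmetric] by (simp add: C_def)
      also have "\<dots> \<le> C * ((\<epsilon> / C) * card (grid N))"
        using C \<open>\<epsilon> > 0\<close> by (intro mult_right_mono) auto
      finally show "\<bar>\<Sum>k\<in>grid N. g' (grid_point N s k) (\<zeta>, 0)\<bar> \<le> \<epsilon> * card (grid N)"
        using C by simp
    qed
  qed
qed

text \<open>The average of \<open>\<Omega>(\<partial>_x, \<partial>_y)\<close> over the torus fibre at height \<open>s\<close> (with \<open>z = x + i y\<close>) does not
  depend on \<open>s\<close>, because \<open>\<Omega>\<close> is closed; the dilation multiplies it by \<open>\<mu>\<close>.\<close>

lemma closed_form_multiplier:
  fixes \<Omega> :: form2 and \<Omega>' :: "C2 \<Rightarrow> C2 \<Rightarrow> C2 \<Rightarrow> C2 \<Rightarrow> real"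
  assumes der: "\<And>p u v. p \<in> CxH \<Longrightarrow> ((\<lambda>x. \<Omega> x u v) has_derivative \<Omega>' u v p) (at p)"
    and cont: "\<And>u v w. continuous_on CxH (\<lambda>p. \<Omega>' u v p w)"
    and closed: "\<And>p u v w. p \<in> CxH \<Longrightarrow> \<Omega>' v w p u - \<Omega>' u w p v + \<Omega>' u v p w = 0"
    and per: "\<And>i p u v. p \<in> CxH \<Longrightarrow> \<Omega> (p + e i) u v = \<Omega> p u v"
    and dil: "\<And>p. p \<in> CxH \<Longrightarrow> \<Omega> (dil 1 p) (1, 0) (\<i>, 0) = \<mu> * \<Omega> p (1, 0) (\<i>, 0)"
    and pos: "\<And>p. p \<in> CxH \<Longrightarrow> \<Omega> p (1, 0) (\<i>, 0) > 0"
  shows "\<mu> = 1"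
proof -
  define h where "h p = \<Omega> p (1, 0) (\<i>, 0)" for p
  define f where "f N s = (\<Sum>k\<in>grid N. h (grid_point N s k))" for N s
  have derh: "(h has_derivative \<Omega>' (1, 0) (\<i>, 0) p) (at p)" if "p \<in> CxH" for p
    unfolding h_def by (rule der[OF that])
  have perh: "h (p + e i) = h p" if "p \<in> CxH" for p i
    using per[OF that] by (simp add: h_def)
  define K where "K = (\<lambda>u. (0, \<i>) + lat u) ` (cbox 0 (\<chi> i. 1))"
  have "K \<subseteq> CxH"
    unfolding K_def by (intro image_subsetI translate_mem_CxH) (simp add: mem_CxH)
  have "compact K"
    unfolding K_def
    by (intro compact_continuous_image compact_cbox continuous_intros
        continuous_on_subset[OF continuous_on_lat]) simp
  have Q1: "grid_point N 1 k \<in> K" if "N > 0" "k \<in> grid N" for N k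
  proof -
    have "0 \<le> real_of_int (k$j) \<and> real_of_int (k$j) \<le> real N" for j
      using that(2) by (auto simp: grid_def less_imp_le) (metis less_imp_le of_int_le_iff of_int_of_nat_eq)
    then have "(1 / real N) *\<^sub>R real_vec k \<in> cbox 0 (\<chi> i. 1)"
      using that(1) by (auto simp: mem_box_cart real_vec_def)
    then show ?thesis
      by (auto simp: K_def grid_point_def)
  qed
  have "continuous_on CxH h"
    using derh has_derivative_continuous by (blast intro: continuous_at_imp_continuous_on)
  moreover have "K \<noteq> {}"
    using Q1[of 1 0] by (auto simp: grid_def)
  ultimately obtain p0 where p0: "p0 \<in> K" "\<And>p. p \<in> K \<Longrightarrow> h p0 \<le> h p"
    using continuous_attains_inf[OF \<open>compact K\<close>] \<open>K \<subseteq> CxH\<close> continuous_on_subset by metis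
  define m where "m = h p0"
  have m: "m > 0"
    unfolding m_def h_def using pos p0(1) \<open>K \<subseteq> CxH\<close> by blast
  have bound: "\<bar>\<mu> - 1\<bar> * m \<le> (\<alpha> - 1) * (2 * \<epsilon>)" if "\<epsilon> > 0" for \<epsilon>
  proof -
    have "\<forall>\<^sub>F N in sequentially. \<forall>s\<in>{1..\<alpha>}.
        \<bar>\<Sum>k\<in>grid N. \<Omega>' (0, \<i>) (\<i>, 0) (grid_point N s k) (1, 0)\<bar> \<le> \<epsilon> * card (grid N)"
      by (rule sum_grid_derivative[OF der cont per \<open>\<epsilon> > 0\<close>])
    moreover have "\<forall>\<^sub>F N in sequentially. \<forall>s\<in>{1..\<alpha>}.
        \<bar>\<Sum>k\<in>grid N. \<Omega>' (0, \<i>) (1, 0) (grid_point N s k) (\<i>, 0)\<bar> \<le> \<epsilon> * card (grid N)"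
      by (rule sum_grid_derivative[OF der cont per \<open>\<epsilon> > 0\<close>])
    ultimately have "\<forall>\<^sub>F N in sequentially. N > 0 \<and> (\<forall>s\<in>{1..\<alpha>}.
        \<bar>\<Sum>k\<in>grid N. \<Omega>' (0, \<i>) (\<i>, 0) (grid_point N s k) (1, 0)\<bar> \<le> \<epsilon> * card (grid N) \<and>
        \<bar>\<Sum>k\<in>grid N. \<Omega>' (0, \<i>) (1, 0) (grid_point N s k) (\<i>, 0)\<bar> \<le> \<epsilon> * card (grid N))"
      using eventually_gt_at_top[of 0] by eventually_elim auto
    from eventually_happens'[OF sequentially_bot this] obtain N where N: "N > 0"
      and small: "\<forall>s\<in>{1..\<alpha>}.
        \<bar>\<Sum>k\<in>grid N. \<Omega>' (0, \<i>) (\<i>, 0) (grid_point N s k) (1, 0)\<bar> \<le> \<epsilon> * card (grid N) \<and>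
        \<bar>\<Sum>k\<in>grid N. \<Omega>' (0, \<i>) (1, 0) (grid_point N s k) (\<i>, 0)\<bar> \<le> \<epsilon> * card (grid N)"
      by (elim exE conjE)
    define f' where "f' s = (\<Sum>k\<in>grid N. \<Omega>' (1, 0) (\<i>, 0) (grid_point N s k) (0, \<i>))" for s
    have f'_small: "\<bar>f' s\<bar> \<le> 2 * \<epsilon> * card (grid N)" if s: "s \<in> {1..\<alpha>}" for s
    proof -
      have "\<Omega>' (1, 0) (\<i>, 0) p (0, \<i>) = \<Omega>' (0, \<i>) (\<i>, 0) p (1, 0) - \<Omega>' (0, \<i>) (1, 0) p (\<i>, 0)"
        if "p \<in> CxH" for p
        using closed[OF that, of "(1, 0)" "(\<i>, 0)" "(0, \<i>)"] by simp
      then have "f' s = (\<Sum>k\<in>grid N. \<Omega>' (0, \<i>) (\<i>, 0) (grid_point N s k) (1, 0)) -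
          (\<Sum>k\<in>grid N. \<Omega>' (0, \<i>) (1, 0) (grid_point N s k) (\<i>, 0))"
        using grid_point_mem_CxH s by (simp add: f'_def sum_subtractf)
      then show ?thesis
        using bspec[OF small s] by linarith
    qed
    have "(f N has_real_derivative f' s) (at s)" if "s \<in> {1..\<alpha>}" for s
    proof -
      have "((\<lambda>s. h (grid_point N s k)) has_real_derivative \<Omega>' (1, 0) (\<i>, 0) (grid_point N s k) (0, \<i>)) (at s)" for k
      proof -
        have C: "grid_point N s k \<in> CxH"
          using grid_point_mem_CxH that by simp
        have "((\<lambda>s. grid_point N s k) has_derivative (\<lambda>t. t *\<^sub>R (0, \<i>))) (at s)"
          unfolding grid_point_def by (auto intro!: derivative_eq_intros simp: scaleR_conv_of_real)
        from diff_chain_at[OF this derh[OF C]]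
        have "((\<lambda>s. h (grid_point N s k)) has_derivative (\<lambda>t. \<Omega>' (1, 0) (\<i>, 0) (grid_point N s k) (t *\<^sub>R (0, \<i>)))) (at s)"
          by (simp only: o_def)
        moreover have "(\<lambda>t. \<Omega>' (1, 0) (\<i>, 0) (grid_point N s k) (t *\<^sub>R (0, \<i>))) =
            (*) (\<Omega>' (1, 0) (\<i>, 0) (grid_point N s k) (0, \<i>))"
          using linear_scale[OF has_derivative_linear[OF derh[OF C]]]
          by (simp add: fun_eq_iff del: scaleR_Pair)
        ultimately show ?thesis
          unfolding has_field_derivative_def by (simp only:)
      qed
      then show ?thesis
        unfolding f_def f'_def by (intro DERIV_sum)
    qed
    then obtain \<xi> where \<xi>: "1 < \<xi>" "\<xi> < \<alpha>" "f N \<alpha> - f N 1 = (\<alpha> - 1) * f' \<xi>"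
      using MVT2[of 1 \<alpha> "f N" f'] alpha_gt_1 by auto
    have "f N \<alpha> = (\<Sum>k\<in>grid N. h (dil 1 (grid_point N 1 k)))"
      using sum_grid_dil[of h, OF perh N, of 1] by (simp add: f_def)
    also have "\<dots> = \<mu> * f N 1"
      using dil grid_point_mem_CxH[of 1] by (simp add: f_def h_def sum_distrib_left)
    finally have "(\<mu> - 1) * f N 1 = (\<alpha> - 1) * f' \<xi>"
      using \<xi>(3) by (simp add: algebra_simps)
    have fm: "m * card (grid N) \<le> f N 1"
      using sum_mono[of "grid N" "\<lambda>_. m" "\<lambda>k. h (grid_point N 1 k)"] p0(2) Q1[OF N]
      by (simp add: f_def m_def mult.commute)
    have "\<bar>\<mu> - 1\<bar> * (m * card (grid N)) \<le> \<bar>\<mu> - 1\<bar> * f N 1"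
      using fm by (intro mult_left_mono) auto
    also have "\<dots> = \<bar>(\<mu> - 1) * f N 1\<bar>"
      using fm m by (simp add: abs_mult) (metis abs_of_nonneg dual_order.trans mult_nonneg_nonneg less_imp_le of_nat_0_le_iff)
    also have "\<dots> = (\<alpha> - 1) * \<bar>f' \<xi>\<bar>"
      using \<open>(\<mu> - 1) * f N 1 = (\<alpha> - 1) * f' \<xi>\<close> alpha_gt_1 by (simp add: abs_mult)
    also have "\<dots> \<le> (\<alpha> - 1) * (2 * \<epsilon> * card (grid N))"
      using f'_small[of \<xi>] \<xi> alpha_gt_1 by (intro mult_left_mono) auto
    finally have "(\<bar>\<mu> - 1\<bar> * m) * card (grid N) \<le> ((\<alpha> - 1) * (2 * \<epsilon>)) * card (grid N)"
      by (simp add: mult.assoc)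
    then show ?thesis
      using card_grid_pos[OF N] by simp
  qed
  show ?thesis
  proof (rule ccontr)
    assume "\<mu> \<noteq> 1"
    then have pos: "\<bar>\<mu> - 1\<bar> * m > 0"
      using m by simp
    define \<epsilon> where "\<epsilon> = \<bar>\<mu> - 1\<bar> * m / (4 * (\<alpha> - 1))"
    have "\<epsilon> > 0"
      unfolding \<epsilon>_def using pos alpha_gt_1 by (intro divide_pos_pos) auto
    moreover have "(\<alpha> - 1) * (2 * \<epsilon>) = \<bar>\<mu> - 1\<bar> * m / 2"
      using alpha_gt_1 by (simp add: \<epsilon>_def field_simps)
    ultimately show False
      using bound[of \<epsilon>] pos by simp
  qed
qed

section \<open>The Lee class of a taming form\<close>

text \<open>Both sides have the same differential, and the covering is convex.\<close>

lemma potential_step: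
  assumes F: "\<And>p. p \<in> CxH \<Longrightarrow> (F has_derivative \<eta> p) (at p)"
    and inv: "\<And>p v. p \<in> CxH \<Longrightarrow> \<eta> (dil n p + lat u) (dil n v) = \<eta> p v"
  shows "\<exists>c::real. \<forall>p\<in>CxH. F (dil n p + lat u) = F p + c"
proof -
  have "\<exists>c. \<forall>p\<in>CxH. F (dil n p + lat u) - F p = c"
  proof (rule has_derivative_zero_constant[OF convex_CxH])
    fix p :: C2 assume p: "p \<in> CxH"
    have "bounded_linear (dil n)"
      using linear_dil linear_conv_bounded_linear by blast
    then have "((\<lambda>q. dil n q + lat u) has_derivative dil n) (at p)"
      by (auto intro!: derivative_eq_intros bounded_linear_imp_has_derivative)
    from diff_chain_at[OF this F[OF translate_mem_CxH[OF dil_mem_CxH[OF p]]]]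
    have "((\<lambda>q. F (dil n q + lat u)) has_derivative (\<lambda>v. \<eta> (dil n p + lat u) (dil n v))) (at p)"
      by (simp only: o_def)
    from has_derivative_diff[OF this F[OF p]]
    have "((\<lambda>q. F (dil n q + lat u) - F q) has_derivative (\<lambda>v. 0)) (at p)"
      by (simp add: inv[OF p])
    then show "((\<lambda>q. F (dil n q + lat u) - F q) has_derivative (\<lambda>v. 0)) (at p within CxH)"
      by (rule has_derivative_at_withinI)
  qed
  then show ?thesis
    by (metis add.commute diff_add_cancel)
qed

text \<open>The periods of a closed one-form over the lattice form a vector fixed by \<open>A\<close>, since
  conjugation with the dilation acts on the lattice as \<open>A\<close>. As 1 is not an eigenvalue, they
  vanish, and only the period \<open>c\<close> of the dilation remains. Thus the first Betti number is 1.\<close>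

lemma potential_periods:
  assumes \<eta>: "\<eta> \<in> closed_one_forms atlas"
    and F: "\<And>p. p \<in> CxH \<Longrightarrow> (F has_derivative lift \<eta> p) (at p)"
  obtains c where "\<And>i p. p \<in> CxH \<Longrightarrow> F (p + e i) = F p"
    "\<And>p. p \<in> CxH \<Longrightarrow> F (dil 1 p) = F p + c"
proof -
  have of: "one_form atlas \<eta>"
    using \<eta> by (simp add: closed_one_forms_def)
  have "\<exists>c. \<forall>p\<in>CxH. F (dil 1 p + lat 0) = F p + c"
    by (rule potential_step[OF F]) (simp_all add: lat_simps lift_one_form_dil[OF of])
  then obtain c where c: "F (dil 1 p) = F p + c" if "p \<in> CxH" for p
    by (auto simp: lat_simps)
  have "\<exists>d. \<forall>p\<in>CxH. F (p + e i) = F p + d" for i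
    using potential_step[OF F, of 0 "axis i 1"] lift_one_form_translate[OF of]
    by (simp add: dil_0 lat_axis)
  then obtain d' where "\<And>i p. p \<in> CxH \<Longrightarrow> F (p + e i) = F p + d' i"
    by metis
  then have d: "F (p + e i) = F p + (\<chi> i. d' i)$i" if "p \<in> CxH" for p i
    using that by simp
  define d where "d = (\<chi> i. d' i)"
  note d = d[folded d_def]
  have "(\<Sum>j\<in>UNIV. of_int (A$i$j) * d$j) = d$i" for i
  proof -
    define p :: C2 where "p = (0, \<i>)"
    have p: "p \<in> CxH"
      by (simp add: p_def mem_CxH)
    have pe: "p + e i \<in> CxH"
      using translate_mem_CxH[OF p] e_eq_lat by simp
    have "F (dil 1 (p + e i)) = F p + d$i + c"
      using c[OF pe] d[OF p] by simp
    moreover have "dil 1 (p + e i) = dil 1 p + lat (real_vec (A$i))"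
      by (simp add: dil_simps dil_e lat_def real_vec_def)
    then have "F (dil 1 (p + e i)) = F p + c + (\<Sum>j\<in>UNIV. of_int (A$i$j) * d$j)"
      using lattice_step[of F d, OF d dil_mem_CxH[OF p], of 1 "A$i"] c[OF p] by simp
    ultimately show ?thesis
      by simp
  qed
  then have "d = 0"
    by (rule eigenvector_1_eq_0)
  then show thesis
    using that c d by simp
qed

text \<open>On the complex \<open>z\<close>-line an alternating form scales by \<open>|\<beta>|^2 = 1 / \<alpha>\<close> under the dilation.\<close>

lemma alternating_beta:
  assumes bl: "bilinear (w :: C2 \<Rightarrow> C2 \<Rightarrow> real)" and alt: "\<And>u. w u u = 0"
  shows "\<alpha> * w (dil 1 (1, 0)) (dil 1 (\<i>, 0)) = w (1, 0) (\<i>, 0)"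
proof -
  define X Y :: C2 where "X = (1, 0)" and "Y = (\<i>, 0)"
  have "w (X + Y) (X + Y) = w X X + w X Y + w Y X + w Y Y"
    using bl by (simp add: bilinear_ladd bilinear_radd)
  then have anti: "w Y X = - w X Y"
    using alt by simp
  have eqs: "dil 1 X = Re \<beta> *\<^sub>R X + Im \<beta> *\<^sub>R Y" "dil 1 Y = (- Im \<beta>) *\<^sub>R X + Re \<beta> *\<^sub>R Y"
    by (simp_all add: dil_1 X_def Y_def complex_eq_iff)
  have "w (dil 1 X) (dil 1 Y) = ((Re \<beta>)\<^sup>2 + (Im \<beta>)\<^sup>2) * w X Y"
    unfolding eqs using bl alt anti
    by (simp add: bilinear_ladd bilinear_radd bilinear_lmul bilinear_rmul bilinear_lsub bilinear_rsub power2_eq_square algebra_simps)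
  then show ?thesis
    using alpha_norm_beta by (simp add: X_def Y_def cmod_power2 mult.assoc[symmetric])
qed

text \<open>If \<open>\<eta> = dF\<close> on the covering, then \<open>d\<^sub>\<eta> \<omega> = 0\<close> says that \<open>exp (- F) \<omega>\<close> is closed. Passing from
  \<open>p\<close> to its image under the dilation multiplies the coefficient of \<open>dx \<and> dy\<close> in this form by
  \<open>exp (- c) \<alpha>\<close>.\<close>

lemma dilation_period:
  assumes \<eta>: "\<eta> \<in> closed_one_forms atlas"
    and \<omega>: "two_form atlas \<omega>" "tames_J atlas \<omega>"
    and tw: "\<And>c p u v w. c \<in> atlas \<Longrightarrow> p \<in> chart_target c \<Longrightarrow> twisted_d2 (\<eta> c) (\<omega> c) p u v w = 0"
    and F: "\<And>p. p \<in> CxH \<Longrightarrow> (F has_derivative lift \<eta> p) (at p)"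
    and per: "\<And>i p. p \<in> CxH \<Longrightarrow> F (p + e i) = F p"
    and c: "\<And>p. p \<in> CxH \<Longrightarrow> F (dil 1 p) = F p + c"
  shows "exp c = \<alpha>"
proof -
  have of: "one_form atlas \<eta>"
    using \<eta> by (simp add: closed_one_forms_def)
  note \<eta>_lift = lift_closed_one_form[OF \<eta>]
  note \<omega>_lift = lift_taming_form[OF \<omega> of tw]
  let ?w = "lift \<omega>"
  define \<Omega> where "\<Omega> p u v = exp (- F p) * ?w p u v" for p u v
  define \<Omega>' where
    "\<Omega>' u v p w = exp (- F p) * (ext_d0 (\<lambda>x. ?w x u v) p w - lift \<eta> p w * ?w p u v)" for p u v w
  have "exp (- c) * \<alpha> = 1"
  proof (rule closed_form_multiplier)
    fix p u v assume p: "p \<in> CxH"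
    have "((\<lambda>x. exp (- F x)) has_derivative (\<lambda>w. - lift \<eta> p w * exp (- F p))) (at p)"
      by (auto intro!: derivative_eq_intros F[OF p])
    from has_derivative_mult[OF this smooth_on_has_derivative[OF \<omega>_lift(4) p, of u v]]
    show "((\<lambda>x. \<Omega> x u v) has_derivative \<Omega>' u v p) (at p)"
      unfolding \<Omega>_def \<Omega>'_def by (simp add: algebra_simps)
  next
    have "continuous_on CxH F"
      using F has_derivative_continuous by (blast intro: continuous_at_imp_continuous_on)
    then show "continuous_on CxH (\<lambda>p. \<Omega>' u v p w)" for u v w
      unfolding \<Omega>'_def
      by (intro continuous_intros smooth_on_imp_continuous_on[OF smooth_on_ext_d0[OF \<omega>_lift(4)]]
          smooth_on_imp_continuous_on[OF \<omega>_lift(4)] smooth_on_imp_continuous_on[OF \<eta>_lift(2)])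
  next
    fix p u v w assume p: "p \<in> CxH"
    have "\<Omega>' v w p u - \<Omega>' u w p v + \<Omega>' u v p w = exp (- F p) * twisted_d2 (lift \<eta>) ?w p u v w"
      unfolding \<Omega>'_def twisted_d2_def ext_d2_def wedge12_def by (simp add: algebra_simps)
    then show "\<Omega>' v w p u - \<Omega>' u w p v + \<Omega>' u v p w = 0"
      using \<omega>_lift(5)[OF _ _ p] by simp
  next
    show "\<Omega> (p + e i) u v = \<Omega> p u v" if "p \<in> CxH" for i p u v
      using per[OF that] lift_two_form_translate[OF \<omega>(1) that] by (simp add: \<Omega>_def)
  next
    fix p assume p: "p \<in> CxH"
    have "\<alpha> * ?w (dil 1 p) (dil 1 (1, 0)) (dil 1 (\<i>, 0)) = ?w (dil 1 p) (1, 0) (\<i>, 0)"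
      using \<omega>_lift(1,2)[OF _ _ dil_mem_CxH[OF p]] by (intro alternating_beta) simp_all
    then have "?w (dil 1 p) (1, 0) (\<i>, 0) = \<alpha> * ?w p (1, 0) (\<i>, 0)"
      using lift_two_form_dil[OF \<omega>(1) p] by simp
    then show "\<Omega> (dil 1 p) (1, 0) (\<i>, 0) = exp (- c) * \<alpha> * \<Omega> p (1, 0) (\<i>, 0)"
      using c[OF p] by (simp add: \<Omega>_def exp_add exp_diff exp_minus field_simps)
  next
    fix p assume p: "p \<in> CxH"
    have "?w p (1, 0) (J_std (1, 0)) > 0"
      by (rule \<omega>_lift(3)[OF _ _ p]) (simp_all add: prod_eq_iff)
    then show "\<Omega> p (1, 0) (\<i>, 0) > 0"
      by (simp add: \<Omega>_def J_std_def)
  qed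
  then show ?thesis
    by (simp add: exp_minus field_simps)
qed

section \<open>The form theta and the Tricerri form\<close>

lemma overlap_cases:
  assumes "c \<in> atlas" "c' \<in> atlas" "p \<in> chart_overlap c c'"
  obtains n l where "p \<in> CxH" "l \<in> lattice" "transition c c' p = dil n p + l"
    "frechet_derivative (transition c c') (at p) = dil n"
proof -
  obtain U V where UV: "c = chart U" "evenly_covered U" "c' = chart V" "evenly_covered V"
    using assms(1,2) unfolding atlas_eq by blast
  then obtain g where g: "p \<in> U" "g \<in> G" "g p \<in> V"
    using assms(3) chart_overlap_chart by blast
  have p: "p \<in> CxH"
    using g(1) UV(2) unfolding evenly_covered_def by blast
  obtain n l where nl: "l \<in> lattice" "\<forall>p\<in>CxH. g p = dil n p + l"
    using G_form[OF g(2)] by blast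
  note tr = transition_chart[OF UV(2,4) g(2) bspec[OF nl(2)] g(1,3), folded UV(1,3)]
  show thesis
    using that[OF p nl(1)] tr nl(2) p by simp
qed

lemma chart_target_CxH: "c \<in> atlas \<Longrightarrow> open (chart_target c) \<and> chart_target c \<subseteq> CxH"
  unfolding atlas_eq using chart_target_chart by (auto simp: evenly_covered_def)

lemma one_form_of_invariant:
  assumes "\<And>p. p \<in> CxH \<Longrightarrow> linear (X p)" and sm: "\<And>v. smooth_on CxH (\<lambda>p. X p v)"
    and inv: "\<And>n l p v. p \<in> CxH \<Longrightarrow> l \<in> lattice \<Longrightarrow> X (dil n p + l) (dil n v) = X p v"
  shows "one_form atlas (\<lambda>c. X)"
  unfolding one_form_def
proof (intro conjI ballI allI)
  fix c c' p v assume "c \<in> atlas" "c' \<in> atlas" "p \<in> chart_overlap c c'"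
  then obtain n l where "p \<in> CxH" "l \<in> lattice" "transition c c' p = dil n p + l"
    "frechet_derivative (transition c c') (at p) = dil n"
    by (rule overlap_cases)
  then show "X p v = X (transition c c' p) (frechet_derivative (transition c c') (at p) v)"
    using inv by simp
qed (use assms(1) smooth_on_subset[OF sm] chart_target_CxH in blast)+

lemma two_form_of_invariant:
  assumes "\<And>p. p \<in> CxH \<Longrightarrow> bilinear (X p)" "\<And>p u. p \<in> CxH \<Longrightarrow> X p u u = 0"
    and sm: "\<And>u v. smooth_on CxH (\<lambda>p. X p u v)"
    and inv: "\<And>n l p u v. p \<in> CxH \<Longrightarrow> l \<in> lattice \<Longrightarrow> X (dil n p + l) (dil n u) (dil n v) = X p u v"
  shows "two_form atlas (\<lambda>c. X)"
  unfolding two_form_def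
proof (intro conjI ballI allI)
  fix c c' p u v assume "c \<in> atlas" "c' \<in> atlas" "p \<in> chart_overlap c c'"
  then obtain n l where "p \<in> CxH" "l \<in> lattice" "transition c c' p = dil n p + l"
    "frechet_derivative (transition c c') (at p) = dil n"
    by (rule overlap_cases)
  then show "X p u v = X (transition c c' p) (frechet_derivative (transition c c') (at p) u)
      (frechet_derivative (transition c c') (at p) v)"
    using inv by simp
qed (use assms(1,2) smooth_on_subset[OF sm] chart_target_CxH in blast)+

lemma Im_snd_shift: "l \<in> lattice \<Longrightarrow> Im (snd (dil n p + l)) = \<alpha> powi n * Im (snd p)"
  by (auto simp: lattice_def Im_snd_dil Im_snd_lat)

lemma theta_derivative:
  assumes "p \<in> CxH"
  shows "((\<lambda>p. Im (snd v) / Im (snd p)) has_derivative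
    (\<lambda>u. - (Im (snd v) * Im (snd u)) / (Im (snd p))\<^sup>2)) (at p)"
  using assms unfolding mem_CxH
  by (auto intro!: derivative_eq_intros simp: power2_eq_square field_simps)

lemma theta_smooth: "smooth_on CxH (\<lambda>p. Im (snd v) / Im (snd p))"
  by (rule smooth_on_cong[OF open_CxH smooth_on_Im_powr[of "Im (snd v)" "-1"]])
    (simp add: mem_CxH powr_minus divide_inverse)

lemma theta_closed: "inoue_theta \<in> closed_one_forms atlas"
proof -
  define X where "X p v = Im (snd v) / Im (snd p)" for p v :: C2
  have theta: "inoue_theta = (\<lambda>c. X)"
    by (simp add: fun_eq_iff inoue_theta_def X_def)
  have "one_form atlas (\<lambda>c. X)"
  proof (rule one_form_of_invariant)
    show "linear (X p)" for p
      unfolding X_def by (rule linearI) (simp_all add: add_divide_distrib)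
    show "smooth_on CxH (\<lambda>p. X p v)" for v
      unfolding X_def by (rule theta_smooth)
    show "X (dil n p + l) (dil n v) = X p v" if "l \<in> lattice" for n l p v
      using Im_snd_shift[OF that] alpha_gt_1 by (simp add: X_def Im_snd_dil)
  qed
  moreover have "ext_d1 X p u v = 0" if "p \<in> CxH" for p u v
  proof -
    have "ext_d0 (\<lambda>p. Im (snd v) / Im (snd p)) p u = - (Im (snd v) * Im (snd u)) / (Im (snd p))\<^sup>2" for u v :: C2
      by (rule ext_d0_eqI[OF theta_derivative[OF that]])
    then show ?thesis
      unfolding ext_d1_def X_def by simp
  qed
  ultimately show ?thesis
    unfolding closed_one_forms_def theta using chart_target_CxH by blast
qed

text \<open>In the coordinates \<open>z = x + i y\<close> and \<open>w = r + i s\<close> this is \<open>s dx \<and> dy + dr \<and> ds / s^2\<close>, the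
  fundamental form of the metric of Tricerri up to a constant factor.\<close>

definition tricerri :: form2 where
  "tricerri p u v = Im (snd p) * Im (cnj (fst u) * fst v) + Im (cnj (snd u) * snd v) / (Im (snd p))\<^sup>2"

lemma tricerri_two_form: "two_form atlas (\<lambda>c. tricerri)"
proof (rule two_form_of_invariant)
  show "bilinear (tricerri p)" for p
    unfolding tricerri_def bilinear_def divide_inverse
    by (intro conjI allI linearI) (simp_all add: algebra_simps)
  show "tricerri p u u = 0" for p u
    by (simp add: tricerri_def)
  show "smooth_on CxH (\<lambda>p. tricerri p u v)" for u v
    by (rule smooth_on_cong[OF open_CxH smooth_on_add_scale[where c = 1, OF open_CxH
          smooth_on_Im_powr[of "Im (cnj (fst u) * fst v)" 1]
          smooth_on_Im_powr[of "Im (cnj (snd u) * snd v)" "-2"]]])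
      (simp add: tricerri_def mem_CxH powr_minus divide_inverse)
  show "tricerri (dil n p + l) (dil n u) (dil n v) = tricerri p u v" if "p \<in> CxH" "l \<in> lattice" for n l p u v
  proof -
    define x where "x = \<alpha> powi n"
    define y where "y = \<beta> powi n"
    have x: "x > 0"
      using alpha_gt_1 by (simp add: x_def)
    have xy: "x * (cmod y)\<^sup>2 = 1"
    proof -
      have "x * (cmod y)\<^sup>2 = (\<alpha> * (cmod \<beta>)\<^sup>2) powi n"
        unfolding x_def y_def norm_power_int power2_eq_square power_int_mult_distrib ..
      then show ?thesis
        by (simp add: alpha_norm_beta)
    qed
    have scale: "Im (cnj (c * z) * (c * w)) = (cmod c)\<^sup>2 * Im (cnj z * w)" for c z w
      unfolding cmod_power2 by (simp add: power2_eq_square algebra_simps)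
    have 1: "Im (cnj (fst (dil n u)) * fst (dil n v)) = (cmod y)\<^sup>2 * Im (cnj (fst u) * fst v)"
      unfolding dil_def fst_conv y_def by (rule scale)
    have 2: "Im (cnj (snd (dil n u)) * snd (dil n v)) = x\<^sup>2 * Im (cnj (snd u) * snd v)"
      unfolding dil_def snd_conv x_def[symmetric] scale norm_of_real power2_abs ..
    have "tricerri (dil n p + l) (dil n u) (dil n v) =
        (x * (cmod y)\<^sup>2) * (Im (snd p) * Im (cnj (fst u) * fst v)) +
        (x\<^sup>2 / x\<^sup>2) * (Im (cnj (snd u) * snd v) / (Im (snd p))\<^sup>2)"
      unfolding tricerri_def Im_snd_shift[OF \<open>l \<in> lattice\<close>] 1 2 x_def[symmetric]
      by (simp add: power_mult_distrib mult_ac)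
    then show ?thesis
      using x by (simp add: xy tricerri_def)
  qed
qed

lemma tricerri_tames: "tames_J atlas (\<lambda>c. tricerri)"
  unfolding tames_J_def
proof (intro ballI allI impI)
  fix c p and v :: C2 assume "c \<in> atlas" "p \<in> chart_target c" "v \<noteq> 0"
  then have s: "Im (snd p) > 0"
    using chart_target_CxH mem_CxH by blast
  have "Im (cnj z * (\<i> * z)) = (cmod z)\<^sup>2" for z
    unfolding cmod_power2 by (simp add: power2_eq_square)
  then have eq: "tricerri p v (J_std v) =
      Im (snd p) * (cmod (fst v))\<^sup>2 + (cmod (snd v))\<^sup>2 / (Im (snd p))\<^sup>2"
    by (simp add: tricerri_def J_std_def)
  show "tricerri p v (J_std v) > 0"
  proof (cases "fst v = 0")
    case True
    then have "snd v \<noteq> 0"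
      using \<open>v \<noteq> 0\<close> by (simp add: prod_eq_iff)
    then show ?thesis
      unfolding eq using s True by simp
  next
    case False
    then show ?thesis
      unfolding eq using s by (intro add_pos_nonneg) simp_all
  qed
qed

lemma tricerri_twisted_closed:
  assumes p: "p \<in> CxH"
  shows "twisted_d2 (inoue_theta c) tricerri p u v w = 0"
proof -
  define s where "s = Im (snd p)"
  have s: "s > 0"
    using p by (simp add: s_def mem_CxH)
  have "((\<lambda>x. tricerri x u v) has_derivative (\<lambda>w. Im (snd w) *
      (Im (cnj (fst u) * fst v) - 2 * Im (cnj (snd u) * snd v) / s ^ 3))) (at p)" for u v
    unfolding tricerri_def
    using s by (auto intro!: derivative_eq_intros simp: s_def[symmetric] field_simps power2_eq_square power3_eq_cube)
  then have d: "ext_d0 (\<lambda>x. tricerri x u v) p w = Im (snd w) *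
      (Im (cnj (fst u) * fst v) - 2 * Im (cnj (snd u) * snd v) / s ^ 3)" for u v w
    by (rule ext_d0_eqI)
  have t: "inoue_theta c p u * tricerri p v w =
      Im (snd u) * (Im (cnj (fst v) * fst w) + Im (cnj (snd v) * snd w) / s ^ 3)" for u v w
    using s by (simp add: inoue_theta_def tricerri_def s_def[symmetric] field_simps power2_eq_square power3_eq_cube)
  \<comment> \<open>Three covectors on the real plane of \<open>w\<close> are linearly dependent.\<close>
  have cyc: "Im (snd u) * Im (cnj (snd v) * snd w) - Im (snd v) * Im (cnj (snd u) * snd w) +
      Im (snd w) * Im (cnj (snd u) * snd v) = 0"
    by (simp add: algebra_simps)
  have "twisted_d2 (inoue_theta c) tricerri p u v w = - 3 / s ^ 3 *
     (Im (snd u) * Im (cnj (snd v) * snd w) - Im (snd v) * Im (cnj (snd u) * snd w) +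
      Im (snd w) * Im (cnj (snd u) * snd v))"
    unfolding twisted_d2_def ext_d2_def wedge12_def d t using s by (simp add: field_simps)
  then show ?thesis
    unfolding cyc by simp
qed

section \<open>The set of taming Lee classes\<close>

text \<open>With \<open>c = ln \<alpha>\<close>, the function \<open>F - ln (Im w)\<close> is invariant under the group and descends to the
  surface.\<close>

lemma taming_class_eq_theta:
  assumes \<eta>: "\<eta> \<in> closed_one_forms atlas"
    and \<omega>: "two_form atlas \<omega>" "tames_J atlas \<omega>"
    and tw: "\<And>c p u v w. c \<in> atlas \<Longrightarrow> p \<in> chart_target c \<Longrightarrow> twisted_d2 (\<eta> c) (\<omega> c) p u v w = 0"
  shows "(inoue_theta, \<eta>) \<in> cohomologous atlas"
proof -
  have "CxH \<noteq> {}"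
    using mem_CxH[of "(0, \<i>)"] by force
  then obtain F where F: "\<And>p. p \<in> CxH \<Longrightarrow> (F has_derivative lift \<eta> p) (at p)" "smooth_on CxH F"
    using closed_one_form_has_potential[OF open_CxH convex_CxH _ lift_closed_one_form[OF \<eta>]] by blast
  obtain c where c: "\<And>i p. p \<in> CxH \<Longrightarrow> F (p + e i) = F p" "\<And>p. p \<in> CxH \<Longrightarrow> F (dil 1 p) = F p + c"
    using potential_periods[OF \<eta> F(1)] by blast
  have "exp c = \<alpha>"
    by (rule dilation_period[OF \<eta> \<omega> tw F(1) c])
  then have ln: "c = ln \<alpha>"
    by (metis ln_exp)
  define \<Phi> where "\<Phi> p = F p - ln (Im (snd p))" for p
  have der: "(\<Phi> has_derivative (\<lambda>v. lift \<eta> p v - Im (snd v) / Im (snd p))) (at p)" if "p \<in> CxH" for p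
    unfolding \<Phi>_def using that
    by (auto intro!: derivative_eq_intros F(1) simp: mem_CxH divide_inverse mult.commute)
  show ?thesis
  proof (rule cohomologousI[OF theta_closed \<eta>])
    have sm: "smooth_on CxH (\<lambda>p. lift \<eta> p v - Im (snd v) / Im (snd p))" for v
      using smooth_on_add_scale[OF open_CxH lift_closed_one_form(2)[OF \<eta>] theta_smooth, of v "-1" v] by simp
    show "smooth_on CxH \<Phi>"
      by (rule smooth_on_if_derivative[OF open_CxH der sm])
    show "\<Phi> (g p) = \<Phi> p" if "g \<in> G" "p \<in> CxH" for g p
    proof (rule G_invariant[OF _ _ that])
      show "\<Phi> (dil 1 p) = \<Phi> p" if "p \<in> CxH" for p
        using c(2)[OF that] that alpha_gt_1 unfolding mem_CxH
        by (simp add: \<Phi>_def ln Im_snd_dil ln_mult)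
      show "\<Phi> (p + e i) = \<Phi> p" if "p \<in> CxH" for i p
        using c(1)[OF that] by (simp add: \<Phi>_def e_def)
    qed
    show "lift \<eta> p v - lift inoue_theta p v = ext_d0 \<Phi> p v" if "p \<in> CxH" for p v
      using ext_d0_eqI[OF der[OF that], of v] by (simp add: lift_def inoue_theta_def)
  qed
qed

text \<open>The cases \<open>r = -1\<close> and \<open>r = 1\<close> give symmetry and transitivity of being cohomologous.\<close>

lemma cohomologous_combine:
  assumes 1: "(\<eta>1, \<eta>1') \<in> cohomologous atlas" and 2: "(\<eta>2, \<eta>2') \<in> cohomologous atlas"
    and \<eta>: "\<eta> \<in> closed_one_forms atlas" "\<eta>' \<in> closed_one_forms atlas"
    and eq: "\<And>c p v. \<eta>' c p v - \<eta> c p v = (\<eta>1' c p v - \<eta>1 c p v) + r * (\<eta>2' c p v - \<eta>2 c p v)"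
  shows "(\<eta>, \<eta>') \<in> cohomologous atlas"
proof -
  obtain f where f: "smooth_fun atlas f"
    "\<forall>c\<in>atlas. \<forall>p\<in>chart_target c. \<forall>v. \<eta>1' c p v - \<eta>1 c p v = ext_d0 (f \<circ> chart_inv c) p v"
    using 1 unfolding cohomologous_def by blast
  obtain g where g: "smooth_fun atlas g"
    "\<forall>c\<in>atlas. \<forall>p\<in>chart_target c. \<forall>v. \<eta>2' c p v - \<eta>2 c p v = ext_d0 (g \<circ> chart_inv c) p v"
    using 2 unfolding cohomologous_def by blast
  define h where "h x = f x + r * g x" for x
  have sm: "smooth_on (chart_target c) (f \<circ> chart_inv c)" "smooth_on (chart_target c) (g \<circ> chart_inv c)"
    if "c \<in> atlas" for c
    using f(1) g(1) that by (simp_all add: smooth_fun_def)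
  have h: "h \<circ> chart_inv c = (\<lambda>p. (f \<circ> chart_inv c) p + r * (g \<circ> chart_inv c) p)" for c
    by (simp add: h_def fun_eq_iff)
  have "smooth_fun atlas h"
    unfolding smooth_fun_def h using smooth_on_add_scale[OF _ sm] chart_target_CxH by blast
  moreover have "\<eta>' c p v - \<eta> c p v = ext_d0 (h \<circ> chart_inv c) p v"
    if c: "c \<in> atlas" and p: "p \<in> chart_target c" for c p v
  proof -
    have "(h \<circ> chart_inv c has_derivative
        (\<lambda>v. ext_d0 (f \<circ> chart_inv c) p v + r * ext_d0 (g \<circ> chart_inv c) p v)) (at p)"
      unfolding h by (intro has_derivative_add has_derivative_mult_right
          smooth_on_has_derivative[OF sm(1)[OF c] p] smooth_on_has_derivative[OF sm(2)[OF c] p])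
    then have "ext_d0 (h \<circ> chart_inv c) p v =
        ext_d0 (f \<circ> chart_inv c) p v + r * ext_d0 (g \<circ> chart_inv c) p v"
      by (rule ext_d0_eqI)
    moreover have "\<eta>1' c p v - \<eta>1 c p v = ext_d0 (f \<circ> chart_inv c) p v"
      "\<eta>2' c p v - \<eta>2 c p v = ext_d0 (g \<circ> chart_inv c) p v"
      using f(2) g(2) c p by blast+
    ultimately show ?thesis
      unfolding eq by (simp only:)
  qed
  ultimately show ?thesis
    using \<eta> unfolding cohomologous_def by blast
qed

lemma deRham_class_eqI:
  assumes "(\<eta>, \<eta>') \<in> cohomologous atlas"
  shows "deRham_class atlas \<eta> = deRham_class atlas \<eta>'"
proof -
  have cl: "\<zeta> \<in> closed_one_forms atlas" "\<zeta>' \<in> closed_one_forms atlas"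
    if "(\<zeta>, \<zeta>') \<in> cohomologous atlas" for \<zeta> \<zeta>'
    using that by (simp_all add: cohomologous_def)
  have "(\<eta>', \<zeta>) \<in> cohomologous atlas" if "(\<eta>, \<zeta>) \<in> cohomologous atlas" for \<zeta>
    by (rule cohomologous_combine[OF that assms cl(2)[OF assms] cl(2)[OF that], of "-1"]) simp
  moreover have "(\<eta>, \<zeta>) \<in> cohomologous atlas" if "(\<eta>', \<zeta>) \<in> cohomologous atlas" for \<zeta>
    by (rule cohomologous_combine[OF that assms cl(1)[OF assms] cl(2)[OF that], of 1]) simp
  ultimately show ?thesis
    unfolding deRham_class_def by blast
qed

theorem taming_Lee_classes_atlas:
  "taming_Lee_classes atlas = {deRham_class atlas inoue_theta}"
  "deRham_class atlas inoue_theta \<in> deRham_H1 atlas"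
proof -
  show H1: "deRham_class atlas inoue_theta \<in> deRham_H1 atlas"
    unfolding deRham_H1_def deRham_class_def by (rule quotientI[OF theta_closed])
  show "taming_Lee_classes atlas = {deRham_class atlas inoue_theta}"
  proof (intro equalityI subsetI)
    fix h assume "h \<in> taming_Lee_classes atlas"
    then obtain \<eta> \<omega> where \<eta>: "\<eta> \<in> closed_one_forms atlas" "h = deRham_class atlas \<eta>"
      and \<omega>: "two_form atlas \<omega>" "tames_J atlas \<omega>"
      and tw: "\<forall>c\<in>atlas. \<forall>p\<in>chart_target c. \<forall>u v w. twisted_d2 (\<eta> c) (\<omega> c) p u v w = 0"
      unfolding taming_Lee_classes_def by blast
    have "(inoue_theta, \<eta>) \<in> cohomologous atlas"
      by (rule taming_class_eq_theta[OF \<eta>(1) \<omega>]) (use tw in blast)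
    then show "h \<in> {deRham_class atlas inoue_theta}"
      using deRham_class_eqI \<eta>(2) by blast
  next
    fix h assume "h \<in> {deRham_class atlas inoue_theta}"
    moreover have "\<forall>c\<in>atlas. \<forall>p\<in>chart_target c. \<forall>u v w. twisted_d2 (inoue_theta c) tricerri p u v w = 0"
      using tricerri_twisted_closed chart_target_CxH by blast
    ultimately show "h \<in> taming_Lee_classes atlas"
      unfolding taming_Lee_classes_def
      using H1 theta_closed tricerri_two_form tricerri_tames by blast
  qed
qed

end

theorem mainTheorem5:
  fixes A :: "int^3^3" and \<alpha> :: real and \<beta> :: complex and a :: "real^3" and b :: "complex^3"
  assumes "inoue_S0_data A \<alpha> \<beta> a b"
  shows "taming_Lee_classes (inoue_S0 \<alpha> \<beta> a b) = {deRham_class (inoue_S0 \<alpha> \<beta> a b) inoue_theta} \<and>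
    {deRham_class (inoue_S0 \<alpha> \<beta> a b) inoue_theta} \<subseteq> deRham_H1 (inoue_S0 \<alpha> \<beta> a b)"
proof -
  interpret inoue_data A \<alpha> \<beta> a b
    by (rule inoue_data.intro) (rule assms)
  show ?thesis
    using taming_Lee_classes_atlas unfolding atlas_def by blast
qed

end
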